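(* For every integer $m\geq1$ and every odd dimension $2n+1\geq3$ there exists a $b^m$-contact trap of dimension $2n+1$.
   Context: $D^{N-1}$ denotes the closed $(N-1)$-dimensional disk and $t$ the coordinate on $[0,1]$. A trap of dimension $N$ is a smooth vector field on $D^{N-1}\times[0,1]$ such that: (1) the vector field is $\frac{\partial}{\partial t}$ near $\partial D^{N-1}\times[0,1]$; (2) there are no (non-constant) periodic orbits contained in $D^{N-1}\times[0,1]$; (3) the orbit entering at the origin of the disk $D^{N-1}\times\{0\}$ does not leave $D^{N-1}\times[0,1]$ again. A $b^m$-contact trap is a trap which is the Reeb vector field of a $b^m$-contact form on $D^{N-1}\times[0,1]$, for some critical hypersurface. $b^m$-contact forms: let $M$ be a manifold with a hypersurface $Z=z^{-1}(0)$, $z:M\to\mathbb{R}$ a defining function ($dz\neq0$ along $Z$). A $b^m$-vector field is a smooth vector field $v$ with $v(z)\in z^mC^\infty(M)$. These are the sections of a vector bundle ${}^{b^m}TM$, locally spanned by $z^m\partial_z$ and the coordinate fields along $Z$. A $b^m$-form of degree $k$ is a section of $\Lambda^k({}^{b^m}TM)^*$; it can be written $\frac{dz}{z^m}\wedge\eta+\beta$ with $\eta,\beta$ smooth forms. The exterior derivative is the extension of the usual one on $M\setminus Z$. A $b^m$-contact form on $M^{2n+1}$ is a $b^m$-form $\alpha$ of degree 1 with $\alpha\wedge(d\alpha)^n\neq0$ everywhere as a section of $\Lambda^{2n+1}({}^{b^m}TM)^*$. $Z$ is its critical hypersurface, and its Reeb vector field is the unique $b^m$-vector field $R_\alpha$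 with $\iota_{R_\alpha}d\alpha=0$, $\alpha(R_\alpha)=1$ (as a smooth vector field it may vanish at points of $Z$). *)

theory Defs
  imports "HOL-Analysis.Analysis"
begin

section \<open>Smooth maps\<close>

fun Ck_on :: "nat \<Rightarrow> 'a::real_normed_vector set \<Rightarrow> ('a \<Rightarrow> 'b::real_normed_vector) \<Rightarrow> bool" where
  "Ck_on 0 U f \<longleftrightarrow> continuous_on U f"
| "Ck_on (Suc k) U f \<longleftrightarrow>
     (\<forall>x\<in>U. f differentiable (at x)) \<and> (\<forall>v. Ck_on k U (\<lambda>x. frechet_derivative f (at x) v))"

text \<open>
  The manifold \<open>M\<close> below is a closed domain with boundary and corners in a Euclidean space. A
  smooth object on \<open>M\<close> is one that extends smoothly to an open neighbourhood of \<open>M\<close>; we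
  represent it by a total function that is already such an extension, so that derivatives at points
  of \<open>M\<close> can be taken in the ambient space. All other conditions are imposed at points of \<open>M\<close>
  only. For domains in which every point is a limit of interior points, derivatives at points of
  \<open>M\<close> do not depend on the extension.
\<close>

definition smooth_near :: "'a::real_normed_vector set \<Rightarrow> ('a \<Rightarrow> 'b::real_normed_vector) \<Rightarrow> bool" where
  "smooth_near M f \<longleftrightarrow> (\<exists>U. open U \<and> M \<subseteq> U \<and> (\<forall>k. Ck_on k U f))"


section \<open>Exterior algebra at a point\<close>

text \<open>
  A \<open>k\<close>-form is a function of a sequence of vectors of which only the entries \<open>0, \<dots>, k - 1\<close>
  matter. The wedge product is normalised so that
  \<open>(\<omega> \<and> \<eta>)(v\<^sub>0, v\<^sub>1) = \<omega>(v\<^sub>0) \<eta>(v\<^sub>1) - \<omega>(v\<^sub>1) \<eta>(v\<^sub>0)\<close> for 1-forms.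
\<close>

type_synonym 'v altform = "(nat \<Rightarrow> 'v) \<Rightarrow> real"

definition wedge :: "nat \<Rightarrow> nat \<Rightarrow> 'v altform \<Rightarrow> 'v altform \<Rightarrow> 'v altform" where
  "wedge k l \<omega> \<eta> v =
     (\<Sum>\<sigma> | \<sigma> permutes {..<k + l}.
        of_int (sign \<sigma>) * \<omega> (\<lambda>i. v (\<sigma> i)) * \<eta> (\<lambda>i. v (\<sigma> (k + i)))) / (fact k * fact l)"

fun wedge_power2 :: "'v altform \<Rightarrow> nat \<Rightarrow> 'v altform" where
  "wedge_power2 \<omega> 0 = (\<lambda>v. 1)"
| "wedge_power2 \<omega> (Suc n) = wedge 2 (2 * n) \<omega> (wedge_power2 \<omega> n)"


section \<open>$b^m$-geometry\<close>

text \<open>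
  \<open>Z = {p \<in> M. z p = 0}\<close> is the critical hypersurface. The last condition excludes the degenerate
  cases in which \<open>Z\<close> is empty or only touches the boundary of \<open>M\<close>.
\<close>

definition defining_function :: "'e::euclidean_space set \<Rightarrow> ('e \<Rightarrow> real) \<Rightarrow> bool" where
  "defining_function M z \<longleftrightarrow>
     smooth_near M z \<and>
     (\<forall>p\<in>M. z p = 0 \<longrightarrow> frechet_derivative z (at p) \<noteq> (\<lambda>v. 0)) \<and>
     (\<exists>p\<in>interior M. z p = 0)"

text \<open>
  The fibre at \<open>p\<close> of the $b^m$-tangent bundle, realised inside \<open>'e \<times> \<real>\<close>: the pair \<open>(v, h)\<close>
  consists of the underlying tangent vector \<open>v\<close> and of the value \<open>h\<close> of the $b^m$-form
  \<open>dz / z\<^sup>m\<close>. It is the kernel of a nonzero functional, so it has the dimension of \<open>'e\<close>. A smooth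
  section is a smooth vector field \<open>v\<close> together with a smooth \<open>h\<close> such that \<open>v(z) = z\<^sup>m h\<close>, that is, a
  $b^m$-vector field (\<open>h\<close> is determined by \<open>v\<close> off \<open>Z\<close>, hence everywhere by continuity). Off
  \<open>Z\<close> the map \<open>(v, h) \<mapsto> v\<close> identifies the fibre with the tangent space; at points of \<open>Z\<close> (for
  \<open>m \<ge> 1\<close>) the fibre is the tangent space of \<open>Z\<close> plus the line spanned by \<open>(0, 1)\<close>, which is the
  class of \<open>z\<^sup>m \<partial>\<^sub>z\<close>.
\<close>

definition bm_fibre :: "nat \<Rightarrow> ('e::euclidean_space \<Rightarrow> real) \<Rightarrow> 'e \<Rightarrow> ('e \<times> real) set" where
  "bm_fibre m z p = {(v, h). frechet_derivative z (at p) v = z p ^ m * h}"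

text \<open>
  The pair \<open>(u, \<beta>)\<close> stands for the $b^m$-form \<open>\<alpha> = u dz / z\<^sup>m + \<beta>\<close> of degree 1. Since
  \<open>dz / z\<^sup>m\<close> is closed off \<open>Z\<close>, the exterior derivative is \<open>d\<alpha> = du \<and> dz / z\<^sup>m + d\<beta>\<close>. Both are
  evaluated on elements \<open>(v, h)\<close> of the fibre, on which \<open>dz / z\<^sup>m\<close> takes the value \<open>h\<close>; this is how
  the power \<open>m\<close> and the function \<open>z\<close> enter.
\<close>

type_synonym 'e bm_1form = "('e \<Rightarrow> real) \<times> ('e \<Rightarrow> ('e \<Rightarrow>\<^sub>L real))"

definition bm_smooth_form :: "'e::euclidean_space set \<Rightarrow> 'e bm_1form \<Rightarrow> bool" where
  "bm_smooth_form M \<alpha> \<longleftrightarrow> smooth_near M (fst \<alpha>) \<and> smooth_near M (snd \<alpha>)"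

fun bm_eval :: "'e::euclidean_space bm_1form \<Rightarrow> 'e \<Rightarrow> 'e \<times> real \<Rightarrow> real" where
  "bm_eval (u, \<beta>) p (v, h) = u p * h + blinfun_apply (\<beta> p) v"

fun bm_d_eval :: "'e::euclidean_space bm_1form \<Rightarrow> 'e \<Rightarrow> 'e \<times> real \<Rightarrow> 'e \<times> real \<Rightarrow> real" where
  "bm_d_eval (u, \<beta>) p (v, h) (w, k) =
     (frechet_derivative u (at p) v * k - frechet_derivative u (at p) w * h) +
     (blinfun_apply (frechet_derivative \<beta> (at p) v) w -
      blinfun_apply (frechet_derivative \<beta> (at p) w) v)"

definition bm_volume :: "nat \<Rightarrow> 'e::euclidean_space bm_1form \<Rightarrow> 'e \<Rightarrow> ('e \<times> real) altform" where
  "bm_volume n \<alpha> p =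
     wedge 1 (2 * n) (\<lambda>v. bm_eval \<alpha> p (v 0))
       (wedge_power2 (\<lambda>v. bm_d_eval \<alpha> p (v 0) (v 1)) n)"

definition bm_contact_form ::
  "nat \<Rightarrow> nat \<Rightarrow> 'e::euclidean_space set \<Rightarrow> ('e \<Rightarrow> real) \<Rightarrow> 'e bm_1form \<Rightarrow> bool" where
  "bm_contact_form m n M z \<alpha> \<longleftrightarrow>
     DIM('e) = 2 * n + 1 \<and> defining_function M z \<and> bm_smooth_form M \<alpha> \<and>
     (\<forall>p\<in>M. \<exists>v. (\<forall>i. v i \<in> bm_fibre m z p) \<and> bm_volume n \<alpha> p v \<noteq> 0)"

definition bm_reeb_field ::
  "nat \<Rightarrow> 'e::euclidean_space set \<Rightarrow> ('e \<Rightarrow> real) \<Rightarrow> 'e bm_1form \<Rightarrow> ('e \<Rightarrow> 'e) \<Rightarrow> bool" where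
  "bm_reeb_field m M z \<alpha> R \<longleftrightarrow>
     smooth_near M R \<and>
     (\<exists>h. smooth_near M h \<and>
        (\<forall>p\<in>M. (R p, h p) \<in> bm_fibre m z p \<and>
                bm_eval \<alpha> p (R p, h p) = 1 \<and>
                (\<forall>\<xi>\<in>bm_fibre m z p. bm_d_eval \<alpha> p (R p, h p) \<xi> = 0)))"


section \<open>Traps\<close>

text \<open>The disk has dimension \<open>DIM('a)\<close>, so \<open>trap_domain\<close> has dimension \<open>DIM('a) + 1\<close>.\<close>

definition trap_domain :: "('a::euclidean_space \<times> real) set" where
  "trap_domain = cball 0 1 \<times> {0..1}"

text \<open>
  In the third clause the vector field points strictly into the domain at the origin of the bottom
  disk, so that its orbit does enter there (in particular it is not a constant orbit).
\<close>

definition trap :: "('a::euclidean_space \<times> real \<Rightarrow> 'a \<times> real) \<Rightarrow> bool" where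
  "trap X \<longleftrightarrow>
     smooth_near trap_domain X \<and>
     (\<exists>U. open U \<and> sphere 0 1 \<times> {0..1} \<subseteq> U \<and> (\<forall>p\<in>U \<inter> trap_domain. X p = (0, 1))) \<and>
     (\<forall>\<gamma> T. T > 0 \<and>
        (\<forall>s. \<gamma> s \<in> trap_domain \<and> (\<gamma> has_vector_derivative X (\<gamma> s)) (at s) \<and> \<gamma> (s + T) = \<gamma> s)
        \<longrightarrow> (\<forall>s. \<gamma> s = \<gamma> 0)) \<and>
     snd (X (0, 0)) > 0 \<and>
     (\<exists>\<gamma>. \<gamma> 0 = (0, 0) \<and>
        (\<forall>s\<ge>0. \<gamma> s \<in> trap_domain \<and>
                (\<gamma> has_vector_derivative X (\<gamma> s)) (at s within {0..})))"

definition bm_contact_trap :: "nat \<Rightarrow> ('a::euclidean_space \<times> real \<Rightarrow> 'a \<times> real) \<Rightarrow> bool" where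
  "bm_contact_trap m X \<longleftrightarrow>
     trap X \<and>
     (\<exists>n z \<alpha>. bm_contact_form m n trap_domain z \<alpha> \<and> bm_reeb_field m trap_domain z \<alpha> X)"

end

theory Submission
  imports Defs
begin

text \<open>
  On a $b^m$-manifold the Reeb field may vanish as a vector field: this happens at points of the critical
  hypersurface \<open>Z\<close> where it is a multiple of \<open>z\<^sup>m \<partial>\<^sub>z\<close>. The trap stops an orbit at such a point, so
  that no complicated invariant set is needed inside the domain.

  Let \<open>z\<close> and \<open>y\<close> be two of the coordinates of the disk and let \<open>\<lambda>\<close> be a primitive of the standard
  symplectic form in the others. The form \<open>(8 + y) dz / z\<^sup>m + dt + \<lambda>\<close> is contact with Reeb field
  \<open>\<partial>\<^sub>t\<close>, and \<open>Z = {z = 0}\<close> contains the axis \<open>x = 0\<close> of the cylinder. Consider more generally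

    \<open>\<alpha> = u dz / z\<^sup>m + a dt + \<lambda>\<close>.

  Its Reeb direction has \<open>t\<close>-component \<open>u\<^sub>y\<close> and \<open>dz / z\<^sup>m\<close>-component \<open>- a\<^sub>y\<close>. Up to a contribution of
  \<open>\<lambda>\<close>, the contact condition is \<open>a u\<^sub>y - u a\<^sub>y > 0\<close>; it allows \<open>u\<^sub>y = 0\<close> where \<open>u > 0\<close> and \<open>a\<^sub>y < 0\<close>. With
  a bump function \<open>\<chi>\<close> on the disk that is \<open>1\<close> at the origin only, put

    \<open>u = 8 + y - \<kappa>(t) y \<chi>\<close> and \<open>a = 1 - \<epsilon>(t) y \<chi>\<close>,

  where \<open>\<epsilon>\<close> is small and \<open>\<kappa> \<le> 1\<close> with equality only at \<open>t = 1\<close>. Then \<open>\<alpha>\<close> is contact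
  (\<open>density_pos\<close>, \<open>bm_volume_nonzero\<close>), and \<open>u\<^sub>y \<ge> 0\<close> vanishes only at the top end \<open>(0, 1)\<close> of the axis
  (\<open>u_y_nonneg\<close>). Hence \<open>t\<close> is nondecreasing along orbits and a periodic orbit has to stay at
  \<open>(0, 1)\<close>. The axis is invariant because the perturbations are divisible by \<open>y\<close>
  (\<open>reeb_axis\<close>), so the orbit that enters at the origin converges to the rest point \<open>(0, 1)\<close> without
  leaving the domain. Outside the support of \<open>\<chi>\<close> nothing is changed and the field is \<open>\<partial>\<^sub>t\<close>.

  Two pieces of general theory support this: smooth calculus for \<open>Ck_on\<close> including a bump function, and
  the linear algebra that derives \<open>\<alpha> \<and> (d\<alpha>)\<^sup>n \<noteq> 0\<close> from the existence of a Reeb vector and the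
  triviality of the common kernel of \<open>\<alpha>\<close> and \<open>d\<alpha>\<close> (\<open>ex_contact_volume_nonzero\<close>).
\<close>

section \<open>Calculus of smooth maps\<close>

lemma Ck_on_cong:
  assumes "open U" "\<And>x. x \<in> U \<Longrightarrow> f x = g x" "Ck_on k U f"
  shows "Ck_on k U g"
  using assms(2,3)
proof (induction k arbitrary: f g)
  case 0
  then show ?case using continuous_on_cong[of U U f g] by simp
next
  case (Suc k)
  have d: "(g has_derivative frechet_derivative f (at x)) (at x)" if "x \<in> U" for x
  proof (rule has_derivative_transform_within_open[OF _ \<open>open U\<close> that Suc.prems(1)])
    show "(f has_derivative frechet_derivative f (at x)) (at x)"
      using Suc.prems(2) that frechet_derivative_works by auto
  qed
  then have e: "frechet_derivative f (at x) = frechet_derivative g (at x)" if "x \<in> U" for x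
    using that frechet_derivative_at by blast
  have "Ck_on k U (\<lambda>x. frechet_derivative g (at x) v)" for v
  proof (rule Suc.IH)
    show "Ck_on k U (\<lambda>x. frechet_derivative f (at x) v)"
      using Suc.prems(2) by simp
  qed (simp add: e)
  moreover have "g differentiable (at x)" if "x \<in> U" for x
    using d[OF that] differentiable_def by blast
  ultimately show ?case by simp
qed

text \<open>
  The recursive clause of \<open>Ck_on\<close> with an arbitrary expression for the derivative in place of the
  chosen constant \<open>frechet_derivative\<close>. The inductive closure properties below feed it the usual
  differentiation formulas, whose terms have one order of smoothness less.
\<close>

lemma Ck_on_SucI:
  assumes "open U" "\<And>x. x \<in> U \<Longrightarrow> (f has_derivative f' x) (at x)"
    and "\<And>v. Ck_on k U (\<lambda>x. f' x v)"
  shows "Ck_on (Suc k) U f"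
proof -
  have "f' x = frechet_derivative f (at x)" if "x \<in> U" for x
    using assms(2)[OF that] frechet_derivative_at by blast
  then have "Ck_on k U (\<lambda>x. frechet_derivative f (at x) v)" for v
    by (intro Ck_on_cong[OF assms(1) _ assms(3)[of v]]) metis
  moreover have "f differentiable (at x)" if "x \<in> U" for x
    using assms(2)[OF that] differentiable_def by blast
  ultimately show ?thesis by simp
qed

lemma Ck_on_Suc_has_derivative:
  "Ck_on (Suc k) U f \<Longrightarrow> x \<in> U \<Longrightarrow> (f has_derivative frechet_derivative f (at x)) (at x)"
  by (simp add: frechet_derivative_works)

lemma Ck_on_SucD: "Ck_on (Suc k) U f \<Longrightarrow> Ck_on k U f"
proof (induction k arbitrary: f)
  case 0
  then have "\<forall>x\<in>U. f differentiable (at x)" by simp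
  then show ?case
    by (auto intro!: continuous_at_imp_continuous_on differentiable_imp_continuous_within)
next
  case (Suc k)
  from Suc.IH Suc.prems show ?case unfolding Ck_on.simps(2)[of "Suc k"] Ck_on.simps(2)[of k] by blast
qed

lemma Ck_on_frechet_derivative: "Ck_on (Suc k) U f \<Longrightarrow> Ck_on k U (\<lambda>x. frechet_derivative f (at x) v)"
  by simp

lemma Ck_on_const: "open U \<Longrightarrow> Ck_on k U (\<lambda>x. c)"
proof (induction k arbitrary: c)
  case (Suc k)
  then show ?case by (intro Ck_on_SucI[where f'="\<lambda>x v. 0"]) simp_all
qed simp

lemma Ck_on_bounded_linear:
  assumes "open U" "bounded_linear L"
  shows "Ck_on k U f \<Longrightarrow> Ck_on k U (\<lambda>x. L (f x))"
proof (induction k arbitrary: f)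
  case 0
  then show ?case using assms by (auto intro: bounded_linear.continuous_on)
next
  case (Suc k)
  show ?case
    by (rule Ck_on_SucI[OF assms(1)])
      (rule bounded_linear.has_derivative[OF assms(2) Ck_on_Suc_has_derivative[OF Suc.prems]],
        assumption, rule Suc.IH[OF Ck_on_frechet_derivative[OF Suc.prems]])
qed

lemma Ck_on_ident: "open U \<Longrightarrow> Ck_on k U (\<lambda>x. x)"
proof (cases k)
  case (Suc k')
  assume "open U"
  then show ?thesis
    unfolding Suc by (intro Ck_on_SucI[where f'="\<lambda>x v. v"] Ck_on_const) simp_all
qed simp

lemma Ck_on_add:
  assumes "open U"
  shows "Ck_on k U f \<Longrightarrow> Ck_on k U g \<Longrightarrow> Ck_on k U (\<lambda>x. f x + g x)"
proof (induction k arbitrary: f g)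
  case 0
  then show ?case by (auto intro: continuous_on_add)
next
  case (Suc k)
  show ?case
    by (rule Ck_on_SucI[OF assms])
      (rule has_derivative_add[OF Ck_on_Suc_has_derivative[OF Suc.prems(1)]
        Ck_on_Suc_has_derivative[OF Suc.prems(2)]], assumption, assumption,
        rule Suc.IH[OF Ck_on_frechet_derivative[OF Suc.prems(1)] Ck_on_frechet_derivative[OF Suc.prems(2)]])
qed

lemma Ck_on_bilinear:
  assumes "open U" "bounded_bilinear B"
  shows "Ck_on k U f \<Longrightarrow> Ck_on k U g \<Longrightarrow> Ck_on k U (\<lambda>x. B (f x) (g x))"
proof (induction k arbitrary: f g)
  case 0
  then show ?case using assms by (auto intro: bounded_bilinear.continuous_on)
next
  case (Suc k)
  note f = Suc.prems(1) and g = Suc.prems(2)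
  show ?case
  proof (rule Ck_on_SucI[OF assms(1)])
    show "((\<lambda>x. B (f x) (g x)) has_derivative
        (\<lambda>v. B (f x) (frechet_derivative g (at x) v) + B (frechet_derivative f (at x) v) (g x))) (at x)"
      if "x \<in> U" for x
      by (rule bounded_bilinear.FDERIV[OF assms(2) Ck_on_Suc_has_derivative[OF f that]
            Ck_on_Suc_has_derivative[OF g that]])
    show "Ck_on k U (\<lambda>x. B (f x) (frechet_derivative g (at x) v) + B (frechet_derivative f (at x) v) (g x))"
      for v
      by (intro Ck_on_add[OF assms(1)] Suc.IH Ck_on_frechet_derivative Ck_on_SucD[OF f] Ck_on_SucD[OF g] f g)
  qed
qed

lemma Ck_on_mult:
  fixes f g :: "'a::real_normed_vector \<Rightarrow> real"
  shows "open U \<Longrightarrow> Ck_on k U f \<Longrightarrow> Ck_on k U g \<Longrightarrow> Ck_on k U (\<lambda>x. f x * g x)"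
  by (rule Ck_on_bilinear[OF _ bounded_bilinear_mult])

lemma Ck_on_minus: "open U \<Longrightarrow> Ck_on k U f \<Longrightarrow> Ck_on k U (\<lambda>x. - f x)"
  by (rule Ck_on_bounded_linear[OF _ bounded_linear_minus[OF bounded_linear_ident]])

lemma Ck_on_inverse:
  fixes f :: "'a::real_normed_vector \<Rightarrow> real"
  assumes "open U" "\<And>x. x \<in> U \<Longrightarrow> f x \<noteq> 0"
  shows "Ck_on k U f \<Longrightarrow> Ck_on k U (\<lambda>x. inverse (f x))"
proof (induction k)
  case 0
  then show ?case using assms by (auto intro: continuous_on_inverse)
next
  case (Suc k)
  note f = Suc.prems
  show ?case
  proof (rule Ck_on_SucI[OF assms(1)])
    show "((\<lambda>x. inverse (f x)) has_derivative
        (\<lambda>v. - (inverse (f x) * frechet_derivative f (at x) v * inverse (f x)))) (at x)"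
      if "x \<in> U" for x
      by (rule Deriv.has_derivative_inverse[OF assms(2)[OF that] Ck_on_Suc_has_derivative[OF f that]])
    show "Ck_on k U (\<lambda>x. - (inverse (f x) * frechet_derivative f (at x) v * inverse (f x)))" for v
      by (intro Ck_on_minus Ck_on_mult assms(1) Suc.IH Ck_on_SucD[OF f] Ck_on_frechet_derivative[OF f])
  qed
qed

lemma Ck_on_fst: "open U \<Longrightarrow> Ck_on k U (\<lambda>p. fst p)"
  by (rule Ck_on_bounded_linear[OF _ bounded_linear_fst Ck_on_ident])

lemma Ck_on_snd: "open U \<Longrightarrow> Ck_on k U (\<lambda>p. snd p)"
  by (rule Ck_on_bounded_linear[OF _ bounded_linear_snd Ck_on_ident])

lemma Ck_on_diff:
  assumes "open U" "Ck_on k U f" "Ck_on k U g"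
  shows "Ck_on k U (\<lambda>x. f x - g x)"
  using Ck_on_add[OF assms(1,2) Ck_on_minus[OF assms(1,3)]] by simp

lemma Ck_on_divide_const:
  fixes f :: "'b::real_normed_vector \<Rightarrow> real"
  shows "open U \<Longrightarrow> Ck_on k U f \<Longrightarrow> Ck_on k U (\<lambda>x. f x / c)"
  unfolding divide_inverse by (intro Ck_on_mult Ck_on_const)

lemma Ck_on_power:
  fixes f :: "'b::real_normed_vector \<Rightarrow> real"
  shows "open U \<Longrightarrow> Ck_on k U f \<Longrightarrow> Ck_on k U (\<lambda>x. f x ^ m)"
  by (induction m) (auto intro: Ck_on_mult Ck_on_const)

lemma Ck_on_Pair:
  assumes "open U" "Ck_on k U f" "Ck_on k U g"
  shows "Ck_on k U (\<lambda>x. (f x, g x))"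
proof -
  have "Ck_on k U (\<lambda>x. (f x, 0) + (0, g x))"
    using assms
    by (intro Ck_on_add Ck_on_bounded_linear[of U "\<lambda>y. (y, 0)"] Ck_on_bounded_linear[of U "\<lambda>y. (0, y)"]
        bounded_linear_Pair bounded_linear_ident bounded_linear_zero)
  then show ?thesis by simp
qed

lemma smooth_near_UNIV: "(\<And>k. Ck_on k UNIV f) \<Longrightarrow> smooth_near M f"
  unfolding smooth_near_def by blast

section \<open>A smooth function that is flat at the origin\<close>

text \<open>
  The functions \<open>s\<^sup>-\<^sup>j e\<^sup>-\<^sup>1\<^sup>/\<^sup>s\<close>, extended by zero to \<open>s \<le> 0\<close>. All \<open>j\<close> are treated
  together because the derivative of each function is a combination of the two next ones, so that
  smoothness of the whole family follows by one induction.
\<close>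

definition flat_exp :: "nat \<Rightarrow> real \<Rightarrow> real" where
  "flat_exp j s = (if s > 0 then inverse s ^ j * exp (- inverse s) else 0)"

lemma flat_exp_tendsto_0: "(flat_exp j \<longlongrightarrow> 0) (at 0)"
proof -
  have "((\<lambda>u. u ^ j / exp u) \<longlongrightarrow> 0) (at_top :: real filter)"
    by (rule tendsto_power_div_exp_0)
  then have "((\<lambda>s. inverse s ^ j / exp (inverse s)) \<longlongrightarrow> 0) (at_right (0::real))"
    using filterlim_inverse_at_top_right by (rule filterlim_compose)
  moreover have "\<forall>\<^sub>F s in at_right (0::real). inverse s ^ j / exp (inverse s) = flat_exp j s"
    by (auto simp: eventually_at_filter flat_exp_def exp_minus divide_inverse)
  ultimately have "(flat_exp j \<longlongrightarrow> 0) (at_right 0)"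
    by (rule Lim_transform_eventually)
  moreover have "(flat_exp j \<longlongrightarrow> 0) (at_left 0)"
    by (rule tendsto_eventually) (auto simp: eventually_at_filter flat_exp_def)
  ultimately show ?thesis by (simp add: filterlim_at_split)
qed

lemma flat_exp_has_derivative:
  "(flat_exp j has_real_derivative flat_exp (j + 2) s - real j * flat_exp (j + 1) s) (at s)"
proof -
  consider "s < 0" | "s = 0" | "s > 0" by linarith
  then show ?thesis
  proof cases
    case 1
    have "(flat_exp j has_real_derivative 0) (at s)"
      by (rule has_field_derivative_transform_within_open[OF DERIV_const, where S="{..<0}"])
        (use 1 in \<open>auto simp: flat_exp_def\<close>)
    with 1 show ?thesis by (simp add: flat_exp_def)
  next
    case 2
    have "((\<lambda>h. flat_exp j h / h) \<longlongrightarrow> 0) (at 0)"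
      by (rule Lim_transform_eventually[OF flat_exp_tendsto_0[of "Suc j"]])
        (auto simp: flat_exp_def eventually_at_filter divide_inverse)
    then show ?thesis
      using 2 by (simp add: DERIV_def flat_exp_def)
  next
    case 3
    have "((\<lambda>s. inverse s ^ j) has_real_derivative - (real j * inverse s ^ Suc j)) (at s)"
    proof (cases j)
      case (Suc i)
      have "((\<lambda>s. inverse s ^ Suc i) has_real_derivative
          real (Suc i) * inverse s ^ i * - (inverse s * inverse s)) (at s)"
        using 3 DERIV_power_Suc[OF DERIV_inverse'[OF DERIV_ident], of s i]
        by (simp add: algebra_simps)
      then show ?thesis by (simp add: Suc algebra_simps)
    qed simp
    moreover have "((\<lambda>s. exp (- inverse s)) has_real_derivative (inverse s)\<^sup>2 * exp (- inverse s)) (at s)"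
      using 3 by (auto intro!: derivative_eq_intros simp: power2_eq_square)
    ultimately have "((\<lambda>s. inverse s ^ j * exp (- inverse s)) has_real_derivative
        - (real j * inverse s ^ Suc j) * exp (- inverse s) +
          (inverse s)\<^sup>2 * exp (- inverse s) * inverse s ^ j) (at s)"
      by (rule DERIV_mult)
    then have "((\<lambda>s. inverse s ^ j * exp (- inverse s)) has_real_derivative
        flat_exp (j + 2) s - real j * flat_exp (j + 1) s) (at s)"
      by (rule DERIV_cong) (use 3 in \<open>simp add: flat_exp_def power2_eq_square mult.assoc mult.left_commute\<close>)
    then show ?thesis
      by (rule has_field_derivative_transform_within_open[where S="{0<..}"])
        (use 3 in \<open>auto simp: flat_exp_def\<close>)
  qed
qed

lemma Ck_on_flat_exp:
  assumes "open U"
  shows "Ck_on k U f \<Longrightarrow> Ck_on k U (\<lambda>x. flat_exp j (f x))"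
proof (induction k arbitrary: j)
  case 0
  have "continuous_on UNIV (flat_exp j)"
    using flat_exp_has_derivative DERIV_isCont by (blast intro: continuous_at_imp_continuous_on)
  then show ?case using 0 by (auto intro: continuous_on_compose2)
next
  case (Suc k)
  note f = Suc.prems
  show ?case
  proof (rule Ck_on_SucI[OF assms])
    show "((\<lambda>x. flat_exp j (f x)) has_derivative
        (\<lambda>v. (flat_exp (j + 2) (f x) + (- real j) * flat_exp (j + 1) (f x)) * frechet_derivative f (at x) v)) (at x)"
      if "x \<in> U" for x
      using has_derivative_compose[OF Ck_on_Suc_has_derivative[OF f that],
          OF flat_exp_has_derivative[unfolded has_field_derivative_def]] by simp
    show "Ck_on k U (\<lambda>x. (flat_exp (j + 2) (f x) + (- real j) * flat_exp (j + 1) (f x)) *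
        frechet_derivative f (at x) v)" for v
      by (intro Ck_on_add Ck_on_mult Ck_on_const assms Suc.IH Ck_on_SucD[OF f] Ck_on_frechet_derivative[OF f])
  qed
qed

lemma flat_exp_nonneg: "0 \<le> flat_exp j s"
  by (simp add: flat_exp_def)

lemma flat_exp_0_le: "s \<le> 1 \<Longrightarrow> exp 1 * flat_exp 0 s \<le> 1"
  by (auto simp: flat_exp_def simp flip: exp_add simp: one_le_inverse_iff)

lemma flat_exp_0_eq: "s \<le> 1 \<Longrightarrow> exp 1 * flat_exp 0 s = 1 \<Longrightarrow> s = 1"
  by (auto simp: flat_exp_def simp flip: exp_add split: if_splits)

lemma flat_exp_2_le: "flat_exp 2 s \<le> 2"
proof (cases "s > 0")
  case True
  have "(inverse s)\<^sup>2 \<le> exp (inverse s) * 2"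
    using exp_lower_Taylor_quadratic[of "inverse s"] True positive_imp_inverse_positive[OF True] by linarith
  then show ?thesis
    using True by (simp add: flat_exp_def exp_minus divide_simps ac_simps)
qed (simp add: flat_exp_def)

section \<open>Evaluating top powers of 2-forms\<close>

text \<open>
  The wedge product feeds its second factor with the entries after the first \<open>k\<close>. A permutation that
  fixes the first \<open>k\<close> entries thus acts on the arguments of that factor alone, with the same sign.
\<close>

lemma permutes_shift:
  fixes k m :: nat
  assumes \<sigma>: "\<sigma> permutes {..<k + m}" and fix_k: "\<And>i. i < k \<Longrightarrow> \<sigma> i = i"
  shows "\<exists>\<tau>. \<tau> permutes {..<m} \<and> sign \<tau> = sign \<sigma> \<and> (\<forall>i. \<sigma> (k + i) = k + \<tau> i)"
proof -
  let ?A = "{k..<k + m}"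
  define \<tau> where "\<tau> = map_permutation ?A (\<lambda>i. i - k) \<sigma>"
  have \<sigma>A: "\<sigma> permutes ?A"
    by (rule permutes_superset[OF \<sigma>]) (use fix_k in auto)
  have inj: "inj_on (\<lambda>i. i - k) ?A" by (auto simp: inj_on_def)
  have "(\<lambda>i. i - k) ` ?A = {..<m}"
    by (auto simp: image_iff intro!: bexI[of _ "k + x" for x])
  then have \<tau>: "\<tau> permutes {..<m}"
    unfolding \<tau>_def by (intro map_permutation_permutes[OF _ \<sigma>A]) (use inj in \<open>simp add: bij_betw_def\<close>)
  have "\<sigma> (k + i) = k + \<tau> i" for i
  proof (cases "i < m")
    case True
    have "\<tau> i = \<sigma> (k + i) - k"
      using map_permutation_apply[OF inj, of "k + i" \<sigma>] True by (simp add: \<tau>_def)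
    moreover have "\<sigma> (k + i) \<in> ?A"
      using permutes_in_image[OF \<sigma>A] True by simp
    ultimately show ?thesis by simp
  next
    case False
    then show ?thesis
      using permutes_not_in[OF \<sigma>A, of "k + i"] permutes_not_in[OF \<tau>, of i] by simp
  qed
  moreover have "sign \<tau> = sign \<sigma>"
    unfolding \<tau>_def by (rule sign_map_permutation[OF inj \<sigma>A]) simp
  ultimately show ?thesis using \<tau> by blast
qed

text \<open>
  The definition sums over all permutations and not only over shuffles, so composing with \<open>\<tau>\<close> just
  reindexes the sum.
\<close>

lemma wedge_permute:
  assumes \<tau>: "\<tau> permutes {..<k + l}"
  shows "wedge k l \<omega> \<eta> (\<lambda>i. v (\<tau> i)) = of_int (sign \<tau>) * wedge k l \<omega> \<eta> v"
proof -
  let ?f = "\<lambda>v \<sigma>. of_int (sign \<sigma>) * \<omega> (\<lambda>i. v (\<sigma> i)) * \<eta> (\<lambda>i. v (\<sigma> (k + i)))"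
  have "sum (?f v) {\<sigma>. \<sigma> permutes {..<k + l}} = (\<Sum>\<sigma> | \<sigma> permutes {..<k + l}. ?f v (\<tau> \<circ> \<sigma>))"
    by (rule setum_permutations_compose_left[OF \<tau>])
  also have "\<dots> = (\<Sum>\<sigma> | \<sigma> permutes {..<k + l}. of_int (sign \<tau>) * ?f (\<lambda>i. v (\<tau> i)) \<sigma>)"
  proof (rule sum.cong)
    fix \<sigma> assume "\<sigma> \<in> {\<sigma>. \<sigma> permutes {..<k + l}}"
    then have "sign (\<tau> \<circ> \<sigma>) = sign \<tau> * sign \<sigma>"
      using \<tau> by (auto intro!: sign_compose intro: permutes_imp_permutation[of "{..<k + l}"])
    then show "?f v (\<tau> \<circ> \<sigma>) = of_int (sign \<tau>) * ?f (\<lambda>i. v (\<tau> i)) \<sigma>" by simp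
  qed simp
  finally have "wedge k l \<omega> \<eta> v = of_int (sign \<tau>) * wedge k l \<omega> \<eta> (\<lambda>i. v (\<tau> i))"
    by (simp add: wedge_def sum_distrib_left)
  moreover have "of_int (sign \<tau>) * of_int (sign \<tau>) = (1 :: real)"
    by (simp flip: of_int_mult)
  ultimately show ?thesis by (simp flip: mult.assoc)
qed

lemma wedge_power2_permute:
  assumes "\<tau> permutes {..<2 * n}"
  shows "wedge_power2 \<omega> n (\<lambda>i. v (\<tau> i)) = of_int (sign \<tau>) * wedge_power2 \<omega> n v"
proof (cases n)
  case 0
  then show ?thesis using assms by simp
next
  case (Suc m)
  then show ?thesis using wedge_permute[of \<tau> 2 "2 * m"] assms by simp
qed

text \<open>
  Together with the next lemma this moves the evaluation on a symplectic family to the index set: with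
  \<open>g = v\<close> and \<open>s = id\<close> only the Gram matrix of the family is left.
\<close>

lemma wedge_power2_pullback:
  "wedge_power2 \<omega> n (\<lambda>i. g (s i)) = wedge_power2 (\<lambda>s. \<omega> (\<lambda>i. g (s i))) n s"
  by (induction n arbitrary: s) (simp_all add: wedge_def)

lemma wedge_power2_cong:
  assumes "\<And>s. s 0 \<in> A \<Longrightarrow> s 1 \<in> A \<Longrightarrow> \<omega> s = \<omega>' s"
  shows "(\<And>i. i < 2 * n \<Longrightarrow> s i \<in> A) \<Longrightarrow> wedge_power2 \<omega> n s = wedge_power2 \<omega>' n s"
proof (induction n arbitrary: s)
  case (Suc n)
  have mem: "s (\<sigma> i) \<in> A" if "\<sigma> permutes {..<2 + 2 * n}" "i < 2 + 2 * n" for \<sigma> i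
    using Suc.prems[of "\<sigma> i"] permutes_in_image[OF that(1), of i] that(2) by simp
  have "\<omega> (\<lambda>i. s (\<sigma> i)) = \<omega>' (\<lambda>i. s (\<sigma> i))"
    "wedge_power2 \<omega> n (\<lambda>i. s (\<sigma> (2 + i))) = wedge_power2 \<omega>' n (\<lambda>i. s (\<sigma> (2 + i)))"
    if "\<sigma> permutes {..<2 + 2 * n}" for \<sigma>
    using mem[OF that] by (auto intro!: assms Suc.IH)
  then show ?case
    unfolding wedge_power2.simps wedge_def
    by (intro arg_cong2[where f="(/)"] sum.cong) auto
qed simp

text \<open>
  The Gram matrix of a symplectic basis \<open>e\<^sub>0, f\<^sub>0, e\<^sub>1, f\<^sub>1, \<dots>\<close>: entries \<open>1\<close> and \<open>-1\<close> inside each pair of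
  indices \<open>2k, 2k + 1\<close> and zero between different pairs.
\<close>

definition std_gram :: "nat \<Rightarrow> nat \<Rightarrow> real" where
  "std_gram i j = (if i div 2 = j div 2 then real (j mod 2) - real (i mod 2) else 0)"

lemma std_gram_nonzeroE:
  assumes "std_gram i j \<noteq> 0"
  obtains k where "i = 2 * k" "j = 2 * k + 1" | k where "i = 2 * k + 1" "j = 2 * k"
proof -
  have "i div 2 = j div 2" "i mod 2 \<noteq> j mod 2"
    using assms by (auto simp: std_gram_def split: if_splits)
  then have "i = 2 * (i div 2) \<and> j = 2 * (i div 2) + 1 \<or> i = 2 * (i div 2) + 1 \<and> j = 2 * (i div 2)"
    using div_mult_mod_eq[of i 2] div_mult_mod_eq[of j 2]
      not_mod_2_eq_1_eq_0[of i] not_mod_2_eq_1_eq_0[of j] by linarith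
  then show ?thesis using that by blast
qed

lemma std_gram_commute: "std_gram j i = - std_gram i j"
  by (simp add: std_gram_def)

lemma std_gram_add2: "std_gram (2 + i) (2 + j) = std_gram i j"
  by (simp add: std_gram_def)

text \<open>
  The two transpositions exchange the pair \<open>0, 1\<close> with the pair \<open>2k, 2k + 1\<close>: they act on
  \<open>i div 2\<close> as a transposition and leave \<open>i mod 2\<close> alone.
\<close>

lemma std_gram_swap_pairs:
  defines "\<pi> k \<equiv> Transposition.transpose 0 (2 * k) \<circ> Transposition.transpose (1::nat) (2 * k + 1)"
  shows "std_gram (\<pi> k i) (\<pi> k j) = std_gram i j"
proof -
  have \<pi>: "\<pi> k i div 2 = Transposition.transpose 0 k (i div 2) \<and> \<pi> k i mod 2 = i mod 2" for i
  proof (cases "even i")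
    case True
    then obtain a where "i = 2 * a" by blast
    moreover have "2 * a \<noteq> Suc (2 * k)" "2 * a \<noteq> Suc 0" by presburger+
    ultimately show ?thesis by (auto simp: \<pi>_def Transposition.transpose_def)
  next
    case False
    then obtain a where "i = 2 * a + 1" by (auto elim: oddE)
    then show ?thesis by (auto simp: \<pi>_def Transposition.transpose_def)
  qed
  have "\<pi> k i div 2 = \<pi> k j div 2 \<longleftrightarrow> i div 2 = j div 2"
    using \<pi>[of i] \<pi>[of j] transpose_eq_imp_eq by metis
  then show ?thesis
    using \<pi> by (simp add: std_gram_def)
qed

text \<open>
  No two terms in the expansion of \<open>\<omega>\<^sup>n\<^sup>+\<^sup>1\<close> cancel. A term is nonzero only if \<open>\<sigma>\<close> sends \<open>0, 1\<close> to a
  symplectic pair. The transposition of \<open>0\<close> and \<open>1\<close> (which changes two signs) and an exchange of two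
  pairs (which changes none) turn it into a term with \<open>\<sigma> 0 = 0\<close> and \<open>\<sigma> 1 = 1\<close>, and by antisymmetry
  such a term is the value of \<open>\<omega>\<^sup>n\<close> on the remaining pairs.
\<close>

lemma wedge_power2_std_gram_pos: "0 < wedge_power2 (\<lambda>s. std_gram (s 0) (s 1)) n id"
proof (induction n)
  case (Suc n)
  define P where "P = wedge_power2 (\<lambda>s. std_gram (s 0) (s 1)) n"
  define N where "N = 2 + 2 * n"
  define T where "T \<sigma> = of_int (sign \<sigma>) * std_gram (\<sigma> 0) (\<sigma> 1) * P (\<lambda>i. \<sigma> (2 + i))" for \<sigma>
  have P_comp: "P (\<lambda>i. g (s i)) = P s" if "\<And>i j. std_gram (g i) (g j) = std_gram i j" for g s
    unfolding P_def by (subst wedge_power2_pullback) (simp add: that)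
  \<comment> \<open>terms in which \<open>\<sigma>\<close> fixes the first pair\<close>
  have base: "T \<sigma> = P id" if \<sigma>: "\<sigma> permutes {..<N}" and "\<sigma> 0 = 0" "\<sigma> 1 = 1" for \<sigma>
  proof -
    have "\<sigma> i = i" if "i < 2" for i
      using that \<open>\<sigma> 0 = 0\<close> \<open>\<sigma> 1 = 1\<close> by (cases i) auto
    then obtain \<tau> where \<tau>: "\<tau> permutes {..<2 * n}" "sign \<tau> = sign \<sigma>" "\<And>i. \<sigma> (2 + i) = 2 + \<tau> i"
      using permutes_shift[of \<sigma> 2 "2 * n"] \<sigma> unfolding N_def by metis
    have "P (\<lambda>i. \<sigma> (2 + i)) = P (\<lambda>i. id (\<tau> i))"
      unfolding \<tau>(3) id_def by (rule P_comp) (rule std_gram_add2)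
    also have "\<dots> = of_int (sign \<sigma>) * P id"
      unfolding P_def \<tau>(2)[symmetric] by (rule wedge_power2_permute[OF \<tau>(1)])
    finally show ?thesis
      unfolding T_def using that(2,3)
      by (simp add: std_gram_def flip: mult.assoc of_int_mult)
  qed
  \<comment> \<open>terms in which \<open>\<sigma>\<close> maps the first pair to the \<open>k\<close>-th one in the right order\<close>
  have even: "T \<sigma> = P id" if \<sigma>: "\<sigma> permutes {..<N}" and k: "\<sigma> 0 = 2 * k" "\<sigma> 1 = 2 * k + 1" for \<sigma> k
  proof -
    define \<pi> where "\<pi> = Transposition.transpose 0 (2 * k) \<circ> Transposition.transpose (1::nat) (2 * k + 1)"
    have "\<sigma> 1 < N"
      using permutes_in_image[OF \<sigma>, of 1] by (simp add: N_def)
    then have "Transposition.transpose 0 (2 * k) permutes {..<N}" "Transposition.transpose 1 (2 * k + 1) permutes {..<N}"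
      unfolding k by (auto intro!: permutes_swap_id simp: N_def)
    then have \<pi>: "\<pi> permutes {..<N}"
      unfolding \<pi>_def by (rule permutes_compose[rotated])
    have "sign \<pi> = 1"
      unfolding \<pi>_def by (subst sign_compose) (auto simp: sign_swap_id permutation_swap_id)
    then have "sign (\<pi> \<circ> \<sigma>) = sign \<sigma>"
      using \<pi> \<sigma> by (subst sign_compose) (auto intro: permutes_imp_permutation[of "{..<N}"])
    moreover have inv: "std_gram (\<pi> i) (\<pi> j) = std_gram i j" for i j
      unfolding \<pi>_def by (rule std_gram_swap_pairs)
    moreover have "P (\<lambda>i. \<pi> (\<sigma> (2 + i))) = P (\<lambda>i. \<sigma> (2 + i))"
      by (rule P_comp) (rule inv)
    ultimately have "T \<sigma> = T (\<pi> \<circ> \<sigma>)"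
      unfolding T_def by simp
    also have "\<dots> = P id"
      by (rule base[OF permutes_compose[OF \<sigma> \<pi>]]) (use k in \<open>auto simp: \<pi>_def Transposition.transpose_def\<close>)
    finally show ?thesis .
  qed
  have T: "T \<sigma> = P id \<or> T \<sigma> = 0" if \<sigma>: "\<sigma> permutes {..<N}" for \<sigma>
  proof (cases "std_gram (\<sigma> 0) (\<sigma> 1) = 0")
    case False
    then show ?thesis
    proof (cases rule: std_gram_nonzeroE)
      case (1 k)
      then show ?thesis using even[OF \<sigma>] by blast
    next
      case (2 k)
      \<comment> \<open>the first pair goes to the \<open>k\<close>-th one in reverse order\<close>
      let ?t = "Transposition.transpose (0::nat) 1"
      have t: "?t permutes {..<N}" by (rule permutes_swap_id) (auto simp: N_def)
      have "sign (\<sigma> \<circ> ?t) = - sign \<sigma>"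
        using t \<sigma> by (subst sign_compose)
          (auto intro: permutes_imp_permutation[of "{..<N}"] simp: sign_swap_id)
      then have "T \<sigma> = T (\<sigma> \<circ> ?t)"
        unfolding T_def using std_gram_commute[of "\<sigma> 0" "\<sigma> 1"] by (simp add: Transposition.transpose_def)
      also have "\<dots> = P id"
        by (rule even[OF permutes_compose[OF t \<sigma>]]) (use 2 in auto)
      finally show ?thesis by blast
    qed
  qed (simp add: T_def)
  have pos: "0 < P id" using Suc unfolding P_def .
  have "0 < sum T {\<sigma>. \<sigma> permutes {..<N}}"
  proof (rule sum_pos2[where i=id])
    show "0 < T id" using base[of id] pos by (simp add: permutes_id)
    show "0 \<le> T \<sigma>" if "\<sigma> \<in> {\<sigma>. \<sigma> permutes {..<N}}" for \<sigma>
      using T[of \<sigma>] that pos by auto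
  qed (auto simp: finite_permutations)
  then show ?case
    by (simp add: wedge_def T_def P_def N_def)
qed simp

lemma wedge_power2_symplectic_pos:
  assumes "\<And>i j. i < 2 * n \<Longrightarrow> j < 2 * n \<Longrightarrow> \<omega> (v i) (v j) = std_gram i j"
  shows "0 < wedge_power2 (\<lambda>v. \<omega> (v 0) (v 1)) n v"
proof -
  have "wedge_power2 (\<lambda>v. \<omega> (v 0) (v 1)) n (\<lambda>i. v (id i)) =
      wedge_power2 (\<lambda>s. \<omega> (v (s 0)) (v (s 1))) n id"
    by (rule wedge_power2_pullback)
  also have "\<dots> = wedge_power2 (\<lambda>s. std_gram (s 0) (s 1)) n id"
    by (rule wedge_power2_cong[where A="{..<2 * n}"]) (auto simp: assms)
  finally show ?thesis using wedge_power2_std_gram_pos[of n] by simp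
qed

text \<open>
  As \<open>\<alpha>\<close> vanishes on all entries but the first, only permutations that fix \<open>0\<close> contribute, and all of
  them contribute the same positive number.
\<close>

lemma wedge1_wedge_power2_pos:
  assumes \<omega>: "\<And>i j. i < 2 * n \<Longrightarrow> j < 2 * n \<Longrightarrow> \<omega> (v (Suc i)) (v (Suc j)) = std_gram i j"
    and \<alpha>: "\<alpha> (v 0) = 1" "\<And>i. i < 2 * n \<Longrightarrow> \<alpha> (v (Suc i)) = 0"
  shows "0 < wedge 1 (2 * n) (\<lambda>v. \<alpha> (v 0)) (wedge_power2 (\<lambda>v. \<omega> (v 0) (v 1)) n) v"
proof -
  define P where "P = wedge_power2 (\<lambda>v. \<omega> (v 0) (v 1)) n"
  define c where "c = P (\<lambda>i. v (Suc i))"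
  define T where "T \<sigma> = of_int (sign \<sigma>) * \<alpha> (v (\<sigma> 0)) * P (\<lambda>i. v (\<sigma> (1 + i)))" for \<sigma>
  have c: "0 < c"
    unfolding c_def P_def by (rule wedge_power2_symplectic_pos) (rule \<omega>)
  have base: "T \<sigma> = c" if \<sigma>: "\<sigma> permutes {..<1 + 2 * n}" and "\<sigma> 0 = 0" for \<sigma>
  proof -
    have "\<exists>\<tau>. \<tau> permutes {..<2 * n} \<and> sign \<tau> = sign \<sigma> \<and> (\<forall>i. \<sigma> (1 + i) = 1 + \<tau> i)"
      by (rule permutes_shift[OF \<sigma>]) (use that(2) in simp)
    then obtain \<tau> where \<tau>: "\<tau> permutes {..<2 * n}" "sign \<tau> = sign \<sigma>" "\<And>i. \<sigma> (1 + i) = 1 + \<tau> i"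
      by blast
    have "P (\<lambda>i. v (\<sigma> (1 + i))) = of_int (sign \<sigma>) * c"
      unfolding P_def c_def \<tau>(2)[symmetric] \<tau>(3)
      using wedge_power2_permute[OF \<tau>(1), of _ "\<lambda>i. v (1 + i)"] by simp
    then show ?thesis
      unfolding T_def using that(2) \<alpha>(1)
      by (simp flip: mult.assoc of_int_mult)
  qed
  have T: "0 \<le> T \<sigma>" if "\<sigma> permutes {..<1 + 2 * n}" for \<sigma>
  proof (cases "\<sigma> 0")
    case 0
    then show ?thesis using base[OF that] c by simp
  next
    case (Suc i)
    moreover have "\<sigma> 0 < 1 + 2 * n" using permutes_in_image[OF that, of 0] by simp
    ultimately show ?thesis using \<alpha>(2)[of i] by (simp add: T_def)
  qed
  have "0 < sum T {\<sigma>. \<sigma> permutes {..<1 + 2 * n}}"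
  proof (rule sum_pos2[where i=id])
    show "0 < T id" using base[of id] c by (simp add: permutes_id)
  qed (auto simp: finite_permutations intro: T)
  then show ?thesis by (simp add: wedge_def T_def P_def)
qed

section \<open>Symplectic families\<close>

lemma dim_le_Suc_dim_kernel:
  fixes \<phi> :: "'v::euclidean_space \<Rightarrow> real"
  assumes "subspace V" "linear \<phi>"
  shows "dim V \<le> Suc (dim {v \<in> V. \<phi> v = 0})"
proof (cases "\<forall>v\<in>V. \<phi> v = 0")
  case True
  then have "{v \<in> V. \<phi> v = 0} = V" by auto
  then show ?thesis by simp
next
  case False
  then obtain b where b: "b \<in> V" "\<phi> b \<noteq> 0" by auto
  let ?K = "{v \<in> V. \<phi> v = 0}"
  have "V \<subseteq> span (insert b ?K)"
  proof
    fix v assume "v \<in> V"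
    define c where "c = \<phi> v / \<phi> b"
    have "v - c *\<^sub>R b \<in> ?K"
      using \<open>v \<in> V\<close> b assms by (auto simp: c_def subspace_diff subspace_scale linear_diff linear_scale)
    then have "(v - c *\<^sub>R b) + c *\<^sub>R b \<in> span (insert b ?K)"
      by (intro span_add span_scale span_base) simp_all
    then show "v \<in> span (insert b ?K)" by simp
  qed
  then have "dim V \<le> dim (insert b ?K)"
    by (rule dim_mono)
  then show ?thesis by (simp add: dim_insert split: if_splits)
qed

text \<open>
  Symplectic Gram-Schmidt: split off a plane on which \<open>\<omega>\<close> is nondegenerate and continue in its
  \<open>\<omega>\<close>-complement, which loses at most two dimensions and is nondegenerate again.
\<close>

lemma ex_symplectic_family:
  fixes \<omega> :: "'v::euclidean_space \<Rightarrow> 'v \<Rightarrow> real"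
  assumes "bilinear \<omega>" and alt: "\<And>x y. \<omega> y x = - \<omega> x y"
  shows "subspace W \<Longrightarrow> 2 * n \<le> dim W \<Longrightarrow> (\<And>w. w \<in> W \<Longrightarrow> w \<noteq> 0 \<Longrightarrow> \<exists>u\<in>W. \<omega> w u \<noteq> 0) \<Longrightarrow>
    \<exists>v. (\<forall>i<2 * n. v i \<in> W) \<and> (\<forall>i<2 * n. \<forall>j<2 * n. \<omega> (v i) (v j) = std_gram i j)"
proof (induction n arbitrary: W)
  case (Suc n)
  note [simp] = bilinear_ladd[OF assms(1)] bilinear_radd[OF assms(1)] bilinear_lsub[OF assms(1)]
    bilinear_rsub[OF assms(1)] bilinear_lmul[OF assms(1)] bilinear_rmul[OF assms(1)]
  have self [simp]: "\<omega> x x = 0" for x using alt[of x x] by simp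
  have lin: "linear (\<omega> x)" for x using assms(1) by (simp add: bilinear_def)
  have "\<not> W \<subseteq> {0}"
  proof
    assume "W \<subseteq> {0}"
    then have "dim W = 0" by simp
    with Suc.prems(2) show False by simp
  qed
  then obtain e where e: "e \<in> W" "e \<noteq> 0" by auto
  then obtain f0 where f0: "f0 \<in> W" "\<omega> e f0 \<noteq> 0" using Suc.prems(3) by blast
  define f where "f = (1 / \<omega> e f0) *\<^sub>R f0"
  have f: "f \<in> W" "\<omega> e f = 1"
    using f0 Suc.prems(1) by (auto simp: f_def subspace_scale)
  have fe: "\<omega> f e = -1" using alt[of f e] f by simp
  define W1 where "W1 = {w \<in> W. \<omega> e w = 0}"
  define W' where "W' = {w \<in> W1. \<omega> f w = 0}"
  have W1: "subspace W1"
    unfolding W1_def using Suc.prems(1)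
    by (auto simp: subspace_def bilinear_rzero[OF assms(1)])
  have W': "subspace W'"
    unfolding W'_def using W1
    by (auto simp: subspace_def bilinear_rzero[OF assms(1)])
  have "dim W \<le> Suc (dim W1)" "dim W1 \<le> Suc (dim W')"
    unfolding W'_def W1_def[symmetric]
    using dim_le_Suc_dim_kernel[OF Suc.prems(1) lin[of e]] dim_le_Suc_dim_kernel[OF W1 lin[of f]]
    by (auto simp: W1_def)
  then have dim: "2 * n \<le> dim W'" using Suc.prems(2) by simp
  have nondeg: "\<exists>u\<in>W'. \<omega> w u \<noteq> 0" if "w \<in> W'" "w \<noteq> 0" for w
  proof -
    obtain u where u: "u \<in> W" "\<omega> w u \<noteq> 0"
      using Suc.prems(3)[of w] \<open>w \<in> W'\<close> \<open>w \<noteq> 0\<close> by (auto simp: W'_def W1_def)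
    \<comment> \<open>the component of \<open>u\<close> in the \<open>\<omega>\<close>-complement of the plane spanned by \<open>e\<close> and \<open>f\<close>\<close>
    define u' where "u' = u + \<omega> f u *\<^sub>R e - \<omega> e u *\<^sub>R f"
    have "u' \<in> W'"
      using u(1) e(1) f Suc.prems(1) fe
      by (auto simp: u'_def W'_def W1_def subspace_add subspace_diff subspace_scale)
    moreover have "\<omega> w e = 0" "\<omega> w f = 0"
      using \<open>w \<in> W'\<close> alt[of w e] alt[of w f] by (auto simp: W'_def W1_def)
    then have "\<omega> w u' = \<omega> w u" by (simp add: u'_def)
    ultimately show ?thesis using u(2) by metis
  qed
  obtain v where v: "\<And>i. i < 2 * n \<Longrightarrow> v i \<in> W'"
    "\<And>i j. i < 2 * n \<Longrightarrow> j < 2 * n \<Longrightarrow> \<omega> (v i) (v j) = std_gram i j"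
    using Suc.IH[OF W' dim nondeg] by blast
  define v' where "v' i = (case i of 0 \<Rightarrow> e | Suc 0 \<Rightarrow> f | Suc (Suc j) \<Rightarrow> v j)" for i
  have perp: "\<omega> e (v i) = 0" "\<omega> f (v i) = 0" "\<omega> (v i) e = 0" "\<omega> (v i) f = 0" "v i \<in> W" if "i < 2 * n" for i
    using v(1)[OF that] alt[of e "v i"] alt[of f "v i"] by (auto simp: W'_def W1_def)
  have "v' i \<in> W" if "i < 2 * Suc n" for i
    using that e f perp(5) by (auto simp: v'_def split: nat.split)
  moreover have "\<omega> (v' i) (v' j) = std_gram i j" if "i < 2 * Suc n" "j < 2 * Suc n" for i j
  proof -
    consider "i = 0" | "i = 1" | i' where "i = Suc (Suc i')" by (metis One_nat_def not0_implies_Suc)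
    then show ?thesis
    proof cases
      case 1
      then show ?thesis
        using that perp f by (auto simp: v'_def std_gram_def split: nat.split)
    next
      case 2
      then show ?thesis
        using that perp fe by (auto simp: v'_def std_gram_def split: nat.split)
    next
      case 3
      then show ?thesis
        using that perp v(2) std_gram_add2[of i'] by (auto simp: v'_def std_gram_def split: nat.split)
    qed
  qed
  ultimately show ?case by blast
qed simp

text \<open>
  The pointwise contact condition from data that are easier to verify than a top wedge product: a Reeb
  vector, and triviality of the common kernel of \<open>\<alpha>\<close> and \<open>\<omega>\<close>. The form \<open>\<omega>\<close> is then nondegenerate on the
  kernel of \<open>\<alpha>\<close>, and the volume form is evaluated on \<open>R\<close> followed by a symplectic family there.
\<close>

lemma ex_contact_volume_nonzero:
  fixes \<omega> :: "'v::euclidean_space \<Rightarrow> 'v \<Rightarrow> real"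
  assumes \<omega>: "bilinear \<omega>" "\<And>x y. \<omega> y x = - \<omega> x y" and \<alpha>: "linear \<alpha>"
    and V: "subspace V" "2 * n + 1 \<le> dim V"
    and R: "R \<in> V" "\<alpha> R = 1" "\<And>u. u \<in> V \<Longrightarrow> \<omega> R u = 0"
    and nondeg: "\<And>w. w \<in> V \<Longrightarrow> \<alpha> w = 0 \<Longrightarrow> (\<And>u. u \<in> V \<Longrightarrow> \<omega> w u = 0) \<Longrightarrow> w = 0"
  shows "\<exists>v. (\<forall>i. v i \<in> V) \<and>
    wedge 1 (2 * n) (\<lambda>v. \<alpha> (v 0)) (wedge_power2 (\<lambda>v. \<omega> (v 0) (v 1)) n) v \<noteq> 0"
proof -
  define W where "W = {w \<in> V. \<alpha> w = 0}"
  have W: "subspace W"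
    using V(1) \<alpha> by (auto simp: W_def subspace_def linear_0 linear_add linear_scale)
  have dim: "2 * n \<le> dim W"
    using dim_le_Suc_dim_kernel[OF V(1) \<alpha>] V(2) by (simp add: W_def)
  have "\<exists>u\<in>W. \<omega> w u \<noteq> 0" if w: "w \<in> W" "w \<noteq> 0" for w
  proof -
    obtain u where u: "u \<in> V" "\<omega> w u \<noteq> 0"
      using nondeg[of w] w by (auto simp: W_def)
    define u' where "u' = u - \<alpha> u *\<^sub>R R"
    have "u' \<in> W"
      using u(1) R V(1) \<alpha> by (auto simp: u'_def W_def subspace_diff subspace_scale linear_diff linear_scale)
    moreover have "\<omega> w R = 0"
      using \<omega>(2)[of R w] R(3)[of w] w by (simp add: W_def)
    then have "\<omega> w u' = \<omega> w u"
      by (simp add: u'_def bilinear_rsub[OF \<omega>(1)] bilinear_rmul[OF \<omega>(1)])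
    ultimately show ?thesis using u(2) by metis
  qed
  then obtain v where v: "\<And>i. i < 2 * n \<Longrightarrow> v i \<in> W"
    "\<And>i j. i < 2 * n \<Longrightarrow> j < 2 * n \<Longrightarrow> \<omega> (v i) (v j) = std_gram i j"
    using ex_symplectic_family[OF \<omega> W dim] by blast
  \<comment> \<open>entries beyond \<open>2n\<close> do not enter the volume form, but have to lie in \<open>V\<close>\<close>
  define v' where "v' i = (if i = 0 \<or> 2 * n < i then R else v (i - 1))" for i
  have "v' i \<in> V" for i
    using R(1) v(1)[of "i - 1"] by (auto simp: v'_def W_def)
  moreover have "0 < wedge 1 (2 * n) (\<lambda>v. \<alpha> (v 0)) (wedge_power2 (\<lambda>v. \<omega> (v 0) (v 1)) n) v'"
    by (rule wedge1_wedge_power2_pos) (use R v in \<open>auto simp: v'_def W_def\<close>)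
  ultimately show ?thesis by (intro exI[of _ v']) simp
qed

section \<open>A partial complex structure\<close>

text \<open>
  In an orthonormal basis whose vectors are grouped in pairs, \<open>S\<close> kills the first pair and rotates every
  other one by a right angle.
\<close>

lemma ex_partial_complex_structure:
  assumes "DIM('a::euclidean_space) = 2 * n" "n \<ge> 1"
  shows "\<exists>(e1::'a) e2 S. linear S \<and> e1 \<bullet> e1 = 1 \<and> e2 \<bullet> e2 = 1 \<and> e1 \<bullet> e2 = 0 \<and>
    S e1 = 0 \<and> S e2 = 0 \<and> (\<forall>v w. S v \<bullet> w = - (v \<bullet> S w)) \<and>
    (\<forall>v. S (S v) = (v \<bullet> e1) *\<^sub>R e1 + (v \<bullet> e2) *\<^sub>R e2 - v)"
proof -
  obtain b :: "nat \<Rightarrow> 'a" where "bij_betw b {0..<2 * n} Basis"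
    using ex_bij_betw_nat_finite[OF finite_Basis] assms(1) by metis
  then have b: "inj_on b {..<2 * n}" "b ` {..<2 * n} = Basis"
    by (auto simp: bij_betw_def lessThan_atLeast0)
  have bb: "b i \<bullet> b j = (if i = j then 1 else 0)" if "i < 2 * n" "j < 2 * n" for i j
  proof -
    have "b i \<in> Basis" "b j \<in> Basis" using that b(2) by blast+
    then show ?thesis
      using that by (simp add: inner_Basis inj_on_eq_iff[OF b(1)])
  qed
  define s where "s i = (if i < 2 then 0 else if even i then b (i + 1) else - b (i - 1))" for i
  define S where "S v = (\<Sum>i<2 * n. (v \<bullet> b i) *\<^sub>R s i)" for v
  have linS: "linear S"
    unfolding S_def
    by (intro linearI) (simp_all add: inner_add_left scaleR_add_left sum.distrib scaleR_sum_right)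
  have Sb: "S (b i) = s i" if "i < 2 * n" for i
  proof -
    have "S (b i) = (\<Sum>j<2 * n. if i = j then s j else 0)"
      unfolding S_def by (rule sum.cong) (auto simp: bb that)
    then show ?thesis using that by simp
  qed
  have odd_lt: "Suc i < 2 * n" if "even i" "i < 2 * n" for i
    using that by presburger
  have skew: "s i \<bullet> b j = - (b i \<bullet> s j)" if "i < 2 * n" "j < 2 * n" for i j
  proof -
    have even_odd: "2 * k \<noteq> Suc (2 * l)" "Suc (2 * l) \<noteq> 2 * k" for k l :: nat by presburger+
    consider k l where "i = 2 * k" "j = 2 * l" | k l where "i = 2 * k" "j = 2 * l + 1"
      | k l where "i = 2 * k + 1" "j = 2 * l" | k l where "i = 2 * k + 1" "j = 2 * l + 1"
      by (metis evenE oddE)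
    then show ?thesis
      using that odd_lt[of i] odd_lt[of j]
      by cases (auto simp: s_def bb even_odd)
  qed
  have "(\<lambda>v w. S v \<bullet> w) = (\<lambda>v w. - (v \<bullet> S w))"
  proof (rule bilinear_eq_stdbasis)
    show "bilinear (\<lambda>v w. S v \<bullet> w)" "bilinear (\<lambda>v w. - (v \<bullet> S w))"
      unfolding bilinear_def using linS
      by (auto intro!: linearI simp: linear_add linear_scale inner_simps)
    show "S v \<bullet> w = - (v \<bullet> S w)" if "v \<in> Basis" "w \<in> Basis" for v w
      using that skew unfolding b(2)[symmetric] by (auto simp: Sb)
  qed
  moreover have "S \<circ> S = (\<lambda>v. (v \<bullet> b 0) *\<^sub>R b 0 + (v \<bullet> b 1) *\<^sub>R b 1 - v)"
  proof (rule linear_eq_stdbasis)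
    show "linear (S \<circ> S)" by (rule linear_compose[OF linS linS])
    show "linear (\<lambda>v. (v \<bullet> b 0) *\<^sub>R b 0 + (v \<bullet> b 1) *\<^sub>R b 1 - v)"
      by (intro linearI) (simp_all add: inner_simps algebra_simps)
    fix v :: 'a assume "v \<in> Basis"
    then obtain i where i: "i < 2 * n" "v = b i" unfolding b(2)[symmetric] by auto
    have "S (s i) = (if i < 2 then 0 else - b i)"
      using i(1) odd_lt[of i] linS
      by (auto simp: s_def Sb linear_0 linear_neg elim!: oddE)
    moreover have "(b i \<bullet> b 0) *\<^sub>R b 0 + (b i \<bullet> b 1) *\<^sub>R b 1 - b i = (if i < 2 then 0 else - b i)"
      using i(1) assms(2) bb[of i 0] bb[of i 1] by (cases "i = 0"; cases "i = 1") auto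
    ultimately show "(S \<circ> S) v = (v \<bullet> b 0) *\<^sub>R b 0 + (v \<bullet> b 1) *\<^sub>R b 1 - v"
      by (simp add: i Sb)
  qed
  moreover have "S (b 0) = 0" "S (b 1) = 0" "b 0 \<bullet> b 0 = 1" "b 1 \<bullet> b 1 = 1" "b 0 \<bullet> b 1 = 0"
    using assms(2) by (auto simp: Sb bb s_def)
  ultimately show ?thesis using linS
    by (intro exI[of _ "b 0"] exI[of _ "b 1"] exI[of _ S]) (simp add: fun_eq_iff)
qed

section \<open>The Reeb direction at a point\<close>

text \<open>
  The coordinates \<open>z = x \<bullet> e1\<close> and \<open>y = x \<bullet> e2\<close> play a special role. The remaining coordinates of the disk
  carry the symplectic form \<open>\<omega>(v, w) = S v \<bullet> w\<close>, which is the exterior derivative of the 1-form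
  \<open>\<lambda>\<^sub>x(v) = (S x \<bullet> v) / 2\<close>. Since \<open>S\<close> vanishes on \<open>e1\<close> and \<open>e2\<close>, both are defined on the whole space and
  no splitting of it has to be carried along.
\<close>

locale partial_complex =
  fixes e1 e2 :: "'a::euclidean_space" and S :: "'a \<Rightarrow> 'a"
  assumes linear_S: "linear S"
    and e1_e1 [simp]: "e1 \<bullet> e1 = 1" and e2_e2 [simp]: "e2 \<bullet> e2 = 1" and e1_e2 [simp]: "e1 \<bullet> e2 = 0"
    and S_e1 [simp]: "S e1 = 0" and S_e2 [simp]: "S e2 = 0"
    and S_skew: "S v \<bullet> w = - (v \<bullet> S w)"
    and S_S: "S (S v) = (v \<bullet> e1) *\<^sub>R e1 + (v \<bullet> e2) *\<^sub>R e2 - v"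
begin

lemmas S_linear_simps [simp] = linear_add[OF linear_S] linear_diff[OF linear_S] linear_scale[OF linear_S]
  linear_0[OF linear_S] linear_neg[OF linear_S]

lemma e2_e1 [simp]: "e2 \<bullet> e1 = 0"
  by (simp add: inner_commute)

lemma S_inner_e [simp]: "S v \<bullet> e1 = 0" "S v \<bullet> e2 = 0"
  using S_skew[of v] by simp_all

lemma inner_S_self [simp]: "v \<bullet> S v = 0" "S v \<bullet> v = 0"
  using S_skew[of v v] by (simp_all add: inner_commute)

text \<open>
  The exterior derivative of \<open>u dz / z\<^sup>m + a dt + \<lambda>\<close> at a point, evaluated on \<open>((v, s), h)\<close> and
  \<open>((w, r), k)\<close>. Only the differentials of the coefficients enter: \<open>F\<close> and \<open>ft\<close> are the gradient of \<open>u\<close>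
  in the disk and its \<open>t\<close>-derivative, \<open>G\<close> and \<open>gt\<close> those of \<open>a\<close>.
\<close>

definition d_form :: "'a \<Rightarrow> 'a \<Rightarrow> real \<Rightarrow> real \<Rightarrow> ('a \<times> real) \<times> real \<Rightarrow> ('a \<times> real) \<times> real \<Rightarrow> real" where
  "d_form F G ft gt V W = (case (V, W) of (((v, s), h), ((w, r), k)) \<Rightarrow>
    (F \<bullet> v + ft * s) * k - (F \<bullet> w + ft * r) * h +
    ((G \<bullet> v + gt * s) * r - (G \<bullet> w + gt * r) * s) + S v \<bullet> w)"

text \<open>
  Where \<open>u\<^sub>y\<close> and \<open>a\<^sub>y\<close> do not both vanish, the kernel of \<open>d\<alpha>\<close> is spanned by the vector with \<open>dz / z\<^sup>m\<close>-component \<open>- a\<^sub>y\<close>, \<open>t\<close>-component \<open>u\<^sub>y\<close> and the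
  following component in the disk, where \<open>c = z\<^sup>m\<close>. Its \<open>e1\<close>-part is forced by the condition
  \<open>v(z) = z\<^sup>m h\<close>, and the term with \<open>S\<close> is the Hamiltonian vector field, with respect to \<open>\<omega>\<close>, of the
  combination of \<open>u\<close> and \<open>a\<close> whose \<open>y\<close>-derivative is zero.
\<close>

definition reeb_direction :: "'a \<Rightarrow> 'a \<Rightarrow> real \<Rightarrow> real \<Rightarrow> 'a" where
  "reeb_direction F G ft c = - (c * (G \<bullet> e2)) *\<^sub>R e1 + (c * (G \<bullet> e1) - ft + F \<bullet> S G) *\<^sub>R e2
    - S ((F \<bullet> e2) *\<^sub>R G - (G \<bullet> e2) *\<^sub>R F)"

lemma d_form_reeb_direction:
  assumes "w \<bullet> e1 = c * k"
  shows "d_form F G ft gt ((reeb_direction F G ft c, F \<bullet> e2), - (G \<bullet> e2)) ((w, r), k) = 0"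
proof -
  define E where "E = (F \<bullet> e2) *\<^sub>R G - (G \<bullet> e2) *\<^sub>R F"
  have E2: "E \<bullet> e2 = 0" by (simp add: E_def inner_simps)
  have GF: "G \<bullet> S F = - (F \<bullet> S G)" using S_skew[of G F] by (simp add: inner_commute)
  have "S (reeb_direction F G ft c) = - S (S E)" by (simp add: reeb_direction_def E_def)
  then have 1: "S (reeb_direction F G ft c) \<bullet> w = E \<bullet> w - (E \<bullet> e1) * (w \<bullet> e1)"
    by (simp add: S_S inner_simps E2 inner_commute)
  have 2: "F \<bullet> S E = (F \<bullet> e2) * (F \<bullet> S G)" "G \<bullet> S E = (G \<bullet> e2) * (F \<bullet> S G)"
    unfolding E_def by (simp_all add: inner_simps GF)
  have 3: "F \<bullet> reeb_direction F G ft c = - (c * (G \<bullet> e2)) * (F \<bullet> e1) +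
      (c * (G \<bullet> e1) - ft + F \<bullet> S G) * (F \<bullet> e2) - F \<bullet> S E"
    "G \<bullet> reeb_direction F G ft c = - (c * (G \<bullet> e2)) * (G \<bullet> e1) +
      (c * (G \<bullet> e1) - ft + F \<bullet> S G) * (G \<bullet> e2) - G \<bullet> S E"
    by (simp_all only: reeb_direction_def E_def[symmetric] inner_add_right inner_diff_right inner_scaleR_right)
  show ?thesis
    unfolding d_form_def prod.case 1 2 3 assms
    by (simp add: E_def inner_simps algebra_simps)
qed

text \<open>
  The number required to be nonzero is \<open>\<alpha>\<close> of the Reeb direction. Testing \<open>d\<alpha>(v, \<sqdot>) = 0\<close> against \<open>e2\<close> says
  that \<open>(h, s)\<close> is proportional to \<open>(- a\<^sub>y, u\<^sub>y)\<close>; the other directions determine the \<open>\<omega>\<close>-part of \<open>v\<close> from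
  \<open>(h, s)\<close>. Hence \<open>v\<close> is a multiple of the Reeb direction up to its \<open>e2\<close>-part, \<open>\<alpha>(v) = 0\<close> makes the
  multiple zero, and the \<open>e2\<close>-part is killed because \<open>u\<^sub>y\<close> and \<open>a\<^sub>y\<close> are not both zero.
\<close>

lemma d_form_nondegenerate:
  assumes v: "v \<bullet> e1 = c * h" and ker: "\<And>w r k. w \<bullet> e1 = c * k \<Longrightarrow> d_form F G ft gt ((v, s), h) ((w, r), k) = 0"
    and \<alpha>: "f * h + a * s + S x \<bullet> v / 2 = 0"
    and D: "- f * (G \<bullet> e2) + a * (F \<bullet> e2) + S x \<bullet> reeb_direction F G ft c / 2 \<noteq> 0"
  shows "v = 0" "s = 0" "h = 0"
proof -
  have 1: "(F \<bullet> e2) * h + (G \<bullet> e2) * s = 0"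
    using ker[of e2 0 0] by (simp add: d_form_def)
  \<comment> \<open>testing against all \<open>w\<close> that are tangent to the critical hypersurface determines \<open>S v\<close>\<close>
  define E where "E = h *\<^sub>R F + s *\<^sub>R G"
  define q where "q = S v + S (S E)"
  have q: "q \<bullet> e1 = 0" "q \<bullet> e2 = 0" by (simp_all add: q_def inner_simps)
  have "S v \<bullet> q = E \<bullet> q"
    using ker[of q 0 0] q by (simp add: d_form_def E_def inner_simps algebra_simps)
  moreover have "S (S E) \<bullet> q = - (E \<bullet> q)"
    using q by (simp add: S_S inner_simps inner_commute[of _ q])
  moreover have "q \<bullet> q = S v \<bullet> q + S (S E) \<bullet> q"
    by (subst (1) q_def) (rule inner_add_left)
  ultimately have "q = 0" by simp
  then have Sv: "S v = - S (S E)" by (simp add: q_def eq_neg_iff_add_eq_0)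
  have Sxv: "S x \<bullet> v = - (S x \<bullet> S E)"
  proof -
    have "S x \<bullet> v = - (x \<bullet> S v)" by (rule S_skew)
    also have "\<dots> = - (S x \<bullet> S E)" unfolding Sv using S_skew[of x "S E"] by simp
    finally show ?thesis .
  qed
  have Sxr: "S x \<bullet> reeb_direction F G ft c = - (S x \<bullet> S ((F \<bullet> e2) *\<^sub>R G - (G \<bullet> e2) *\<^sub>R F))"
    by (simp add: reeb_direction_def inner_simps)
  let ?D = "- f * (G \<bullet> e2) + a * (F \<bullet> e2) + S x \<bullet> reeb_direction F G ft c / 2"
  have \<alpha>': "f * h + a * s - (h * (S x \<bullet> S F) + s * (S x \<bullet> S G)) / 2 = 0"
  proof -
    have "S x \<bullet> S E = h * (S x \<bullet> S F) + s * (S x \<bullet> S G)" by (simp add: E_def inner_add_right)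
    then show ?thesis using \<alpha> Sxv by argo
  qed
  have D': "?D = - f * (G \<bullet> e2) + a * (F \<bullet> e2) -
      ((F \<bullet> e2) * (S x \<bullet> S G) - (G \<bullet> e2) * (S x \<bullet> S F)) / 2"
    unfolding Sxr by (simp add: inner_simps field_simps)
  have "?D * h = - (G \<bullet> e2) * (f * h + a * s - (h * (S x \<bullet> S F) + s * (S x \<bullet> S G)) / 2)"
    unfolding D' using 1 by algebra
  then show "h = 0" using \<alpha>' D by simp
  have "?D * s = (F \<bullet> e2) * (f * h + a * s - (h * (S x \<bullet> S F) + s * (S x \<bullet> S G)) / 2)"
    unfolding D' using 1 by algebra
  then show "s = 0" using \<alpha>' D by simp
  have "S v = 0" using Sv \<open>h = 0\<close> \<open>s = 0\<close> by (simp add: E_def)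
  then have v': "v = (v \<bullet> e2) *\<^sub>R e2"
    using S_S[of v] v \<open>h = 0\<close> by simp
  have "G \<bullet> v = 0"
    using ker[of 0 0 1] \<open>h = 0\<close> \<open>s = 0\<close> by (simp add: d_form_def)
  then have "(v \<bullet> e2) * (G \<bullet> e2) = 0" by (subst (asm) v') simp
  moreover have "F \<bullet> v = 0"
    using ker[of "c *\<^sub>R e1" 1 0] \<open>h = 0\<close> \<open>s = 0\<close> by (simp add: d_form_def)
  then have "(v \<bullet> e2) * (F \<bullet> e2) = 0" by (subst (asm) v') simp
  moreover have "F \<bullet> e2 \<noteq> 0 \<or> G \<bullet> e2 \<noteq> 0"
    using D unfolding D' by auto
  ultimately show "v = 0" using v' by auto
qed

section \<open>The contact form and its Reeb field\<close>

text \<open>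
  A bump function of \<open>|x|\<^sup>2\<close> with support \<open>|x|\<^sup>2 \<le> 1/2\<close> that takes its maximum \<open>1\<close> only at the origin; its
  gradient is \<open>- 2 dbump(x) x\<close>.
\<close>

definition bump :: "'a \<Rightarrow> real" where
  "bump x = exp 1 * flat_exp 0 (1 - 2 * (x \<bullet> x))"

definition dbump :: "'a \<Rightarrow> real" where
  "dbump x = 2 * exp 1 * flat_exp 2 (1 - 2 * (x \<bullet> x))"

text \<open>
  The strengths of the perturbation of \<open>u\<close> and of \<open>a\<close>. At \<open>t = 1\<close> the value \<open>kappa t = 1\<close> is reached, which
  makes \<open>u\<^sub>y\<close> vanish at the top end of the axis. The two functions are matched so that the function
  \<open>density\<close> below is constant along the axis, where the Reeb flow then becomes a linear equation.
  The constant \<open>8\<close> in \<open>u\<close> keeps \<open>u\<close> positive; it can be added since \<open>dz / z\<^sup>m\<close> is closed.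
\<close>

definition kappa :: "real \<Rightarrow> real" where
  "kappa t = (15 + t) / 16"

definition epsilon :: "real \<Rightarrow> real" where
  "epsilon t = (1 + t) / 128"

definition u_fun :: "'a \<times> real \<Rightarrow> real" where
  "u_fun p = 8 + fst p \<bullet> e2 - kappa (snd p) * (fst p \<bullet> e2) * bump (fst p)"

definition a_fun :: "'a \<times> real \<Rightarrow> real" where
  "a_fun p = 1 - epsilon (snd p) * (fst p \<bullet> e2) * bump (fst p)"

definition grad_u :: "'a \<times> real \<Rightarrow> 'a" where
  "grad_u p = (1 - kappa (snd p) * bump (fst p)) *\<^sub>R e2 +
    (2 * kappa (snd p) * (fst p \<bullet> e2) * dbump (fst p)) *\<^sub>R fst p"

definition grad_a :: "'a \<times> real \<Rightarrow> 'a" where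
  "grad_a p = (2 * epsilon (snd p) * (fst p \<bullet> e2) * dbump (fst p)) *\<^sub>R fst p -
    (epsilon (snd p) * bump (fst p)) *\<^sub>R e2"

definition u_t :: "'a \<times> real \<Rightarrow> real" where
  "u_t p = - ((fst p \<bullet> e2) * bump (fst p) / 16)"

definition a_t :: "'a \<times> real \<Rightarrow> real" where
  "a_t p = - ((fst p \<bullet> e2) * bump (fst p) / 128)"

lemma bump_has_derivative:
  "(bump has_derivative (\<lambda>v. - 2 * dbump x * (x \<bullet> v))) (at x)"
proof -
  have d: "((\<lambda>x. 1 - 2 * (x \<bullet> x)) has_derivative (\<lambda>v. - 4 * (x \<bullet> v))) (at x)"
    by (auto intro!: derivative_eq_intros simp: inner_commute)
  have "((\<lambda>x. flat_exp 0 (1 - 2 * (x \<bullet> x))) has_derivative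
      (\<lambda>v. (flat_exp (0 + 2) (1 - 2 * (x \<bullet> x)) - real 0 * flat_exp (0 + 1) (1 - 2 * (x \<bullet> x))) *
        (- 4 * (x \<bullet> v)))) (at x)"
    by (rule has_derivative_compose[OF d flat_exp_has_derivative[unfolded has_field_derivative_def]])
  from has_derivative_mult_right[OF this, of "exp 1"] show ?thesis
    unfolding bump_def[abs_def]
    by (rule has_derivative_eq_rhs) (simp add: fun_eq_iff dbump_def numeral_2_eq_2)
qed

lemma bump_fst_has_derivative:
  "((\<lambda>p. bump (fst p)) has_derivative (\<lambda>w. - 2 * dbump (fst p) * (fst p \<bullet> fst w))) (at p)"
  by (rule has_derivative_compose[OF has_derivative_fst[OF has_derivative_ident] bump_has_derivative])

lemma u_fun_has_derivative:
  "(u_fun has_derivative (\<lambda>w. grad_u p \<bullet> fst w + u_t p * snd w)) (at p)"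
  unfolding u_fun_def[abs_def] kappa_def grad_u_def u_t_def
  by (rule derivative_eq_intros bump_fst_has_derivative refl | simp)+
    (simp add: fun_eq_iff inner_simps inner_commute field_simps)

lemma a_fun_has_derivative:
  "(a_fun has_derivative (\<lambda>w. grad_a p \<bullet> fst w + a_t p * snd w)) (at p)"
  unfolding a_fun_def[abs_def] epsilon_def grad_a_def a_t_def
  by (rule derivative_eq_intros bump_fst_has_derivative refl | simp)+
    (simp add: fun_eq_iff inner_simps inner_commute field_simps)

definition primitive :: "'a \<Rightarrow> ('a \<times> real) \<Rightarrow>\<^sub>L real" where
  "primitive x = (1 / 2) *\<^sub>R (blinfun_inner_left (S x) o\<^sub>L fst_blinfun)"

lemma primitive_apply [simp]: "blinfun_apply (primitive x) w = S x \<bullet> fst w / 2"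
  by (simp add: primitive_def blinfun.scaleR_left inner_commute)

lemma bounded_linear_primitive: "bounded_linear primitive"
  unfolding linear_conv_bounded_linear[symmetric]
  by (intro linearI blinfun_eqI) (simp_all add: blinfun.bilinear_simps inner_simps add_divide_distrib)

text \<open>
  The smooth part \<open>a dt + \<lambda>\<close> of the contact form.
\<close>

definition beta :: "'a \<times> real \<Rightarrow> ('a \<times> real) \<Rightarrow>\<^sub>L real" where
  "beta p = a_fun p *\<^sub>R snd_blinfun + primitive (fst p)"

lemma beta_has_derivative:
  "(beta has_derivative (\<lambda>w. (grad_a p \<bullet> fst w + a_t p * snd w) *\<^sub>R snd_blinfun + primitive (fst w))) (at p)"
  unfolding beta_def[abs_def]
  by (intro has_derivative_add has_derivative_scaleR_left a_fun_has_derivative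
      bounded_linear.has_derivative[OF bounded_linear_primitive] has_derivative_fst has_derivative_ident)

definition z_fun :: "'a \<times> real \<Rightarrow> real" where
  "z_fun p = fst p \<bullet> e1"

lemma frechet_z_fun: "frechet_derivative z_fun (at p) = (\<lambda>w. fst w \<bullet> e1)"
proof -
  have "(z_fun has_derivative (\<lambda>w. fst w \<bullet> e1)) (at p)"
    unfolding z_fun_def[abs_def] by (auto intro!: derivative_eq_intros)
  then show ?thesis by (rule frechet_derivative_at[symmetric])
qed

lemma bm_fibre_iff: "((w, r), k) \<in> bm_fibre m z_fun p \<longleftrightarrow> w \<bullet> e1 = z_fun p ^ m * k"
  by (simp add: bm_fibre_def frechet_z_fun)

lemma bm_eval_eq:
  "bm_eval (u_fun, beta) p ((v, s), h) = u_fun p * h + a_fun p * s + S (fst p) \<bullet> v / 2"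
  by (simp add: beta_def blinfun.bilinear_simps)

lemma bm_d_eval_eq:
  "bm_d_eval (u_fun, beta) p V W = d_form (grad_u p) (grad_a p) (u_t p) (a_t p) V W"
proof -
  have u: "frechet_derivative u_fun (at p) = (\<lambda>w. grad_u p \<bullet> fst w + u_t p * snd w)"
    by (rule frechet_derivative_at[OF u_fun_has_derivative, symmetric])
  have b: "frechet_derivative beta (at p) =
      (\<lambda>w. (grad_a p \<bullet> fst w + a_t p * snd w) *\<^sub>R snd_blinfun + primitive (fst w))"
    by (rule frechet_derivative_at[OF beta_has_derivative, symmetric])
  obtain v s h w r k where [simp]: "V = ((v, s), h)" "W = ((w, r), k)"
    by (cases V; cases W) auto
  have "S w \<bullet> v = - (S v \<bullet> w)" using S_skew[of w v] by (simp add: inner_commute)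
  then show ?thesis
    by (simp add: u b d_form_def blinfun.bilinear_simps)
qed

definition u_y :: "'a \<times> real \<Rightarrow> real" where
  "u_y p = grad_u p \<bullet> e2"

definition a_y :: "'a \<times> real \<Rightarrow> real" where
  "a_y p = grad_a p \<bullet> e2"

definition reeb_x :: "nat \<Rightarrow> 'a \<times> real \<Rightarrow> 'a" where
  "reeb_x m p = reeb_direction (grad_u p) (grad_a p) (u_t p) (z_fun p ^ m)"

text \<open>
  The value of \<open>\<alpha>\<close> on the Reeb direction, by which the direction has to be divided. It is written without
  reference to \<open>m\<close> because the \<open>z\<^sup>m\<close>-terms lie along \<open>e1\<close> and \<open>e2\<close>, where \<open>\<lambda>\<close> vanishes.
\<close>

definition density :: "'a \<times> real \<Rightarrow> real" where
  "density p = - u_fun p * a_y p + a_fun p * u_y p -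
    S (fst p) \<bullet> S (u_y p *\<^sub>R grad_a p - a_y p *\<^sub>R grad_u p) / 2"

definition reeb :: "nat \<Rightarrow> 'a \<times> real \<Rightarrow> 'a \<times> real" where
  "reeb m p = inverse (density p) *\<^sub>R (reeb_x m p, u_y p)"

definition reeb_h :: "'a \<times> real \<Rightarrow> real" where
  "reeb_h p = - (inverse (density p) * a_y p)"

lemma density_reeb_x:
  "density p = - u_fun p * a_y p + a_fun p * u_y p + S (fst p) \<bullet> reeb_x m p / 2"
  by (simp add: density_def reeb_x_def reeb_direction_def u_y_def a_y_def inner_simps field_simps)

lemma d_form_scaleR:
  "d_form F G ft gt (c *\<^sub>R V) W = c * d_form F G ft gt V W"
  by (simp add: d_form_def split: prod.split) (simp add: algebra_simps)

lemma reeb_eq: "(reeb m p, reeb_h p) = inverse (density p) *\<^sub>R ((reeb_x m p, u_y p), - a_y p)"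
  by (simp add: reeb_def reeb_h_def)

lemma reeb_properties:
  assumes "density p \<noteq> 0"
  shows "(reeb m p, reeb_h p) \<in> bm_fibre m z_fun p"
    and "bm_eval (u_fun, beta) p (reeb m p, reeb_h p) = 1"
    and "W \<in> bm_fibre m z_fun p \<Longrightarrow> bm_d_eval (u_fun, beta) p (reeb m p, reeb_h p) W = 0"
proof -
  have "reeb_x m p \<bullet> e1 = - (z_fun p ^ m * a_y p)"
    by (simp add: reeb_x_def reeb_direction_def a_y_def inner_simps)
  then show "(reeb m p, reeb_h p) \<in> bm_fibre m z_fun p"
    by (simp add: reeb_def reeb_h_def bm_fibre_iff)
  have "bm_eval (u_fun, beta) p (reeb m p, reeb_h p) = inverse (density p) * density p"
    unfolding reeb_def reeb_h_def scaleR_Pair bm_eval_eq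
    by (subst (3) density_reeb_x[of p m]) (simp add: inner_simps algebra_simps)
  then show "bm_eval (u_fun, beta) p (reeb m p, reeb_h p) = 1"
    using assms by simp
  assume "W \<in> bm_fibre m z_fun p"
  then show "bm_d_eval (u_fun, beta) p (reeb m p, reeb_h p) W = 0"
    unfolding bm_d_eval_eq reeb_eq d_form_scaleR
    using d_form_reeb_direction[of _ "z_fun p ^ m"]
    by (cases W) (auto simp: bm_fibre_iff reeb_x_def u_y_def a_y_def)
qed

lemma bilinear_bm_d_eval: "bilinear (bm_d_eval (u_fun, beta) p)"
  unfolding bilinear_def bm_d_eval_eq[abs_def] d_form_def
  by (auto intro!: linearI simp: inner_simps algebra_simps split: prod.split)

lemma bm_d_eval_alternating: "bm_d_eval (u_fun, beta) p W V = - bm_d_eval (u_fun, beta) p V W"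
  unfolding bm_d_eval_eq d_form_def
  using S_skew[of "fst (fst W)" "fst (fst V)"]
  by (cases W; cases V) (auto simp: inner_commute)

lemma linear_bm_eval: "linear (bm_eval (u_fun, beta) p)"
proof -
  have "bm_eval (u_fun, beta) p = (\<lambda>W. u_fun p * snd W + a_fun p * snd (fst W) + S (fst p) \<bullet> fst (fst W) / 2)"
    using bm_eval_eq[of p] by (auto simp: fun_eq_iff simp del: bm_eval.simps)
  then show ?thesis
    by (intro linearI) (simp_all add: inner_simps algebra_simps add_divide_distrib)
qed

lemma bm_volume_nonzero:
  assumes "DIM('a) = 2 * n" "density p \<noteq> 0"
  shows "\<exists>v. (\<forall>i. v i \<in> bm_fibre m z_fun p) \<and> bm_volume n (u_fun, beta) p v \<noteq> 0"
  unfolding bm_volume_def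
proof (rule ex_contact_volume_nonzero[OF bilinear_bm_d_eval bm_d_eval_alternating linear_bm_eval,
      where R="(reeb m p, reeb_h p)"])
  let ?V = "bm_fibre m z_fun p"
  define \<phi> where "\<phi> W = fst (fst W) \<bullet> e1 - z_fun p ^ m * snd W" for W :: "('a \<times> real) \<times> real"
  have \<phi>: "linear \<phi>"
    by (rule linearI) (simp_all add: \<phi>_def inner_simps algebra_simps)
  have V: "?V = {W \<in> UNIV. \<phi> W = 0}"
    by (auto simp: \<phi>_def bm_fibre_iff)
  show "subspace ?V"
    unfolding V using \<phi> by (auto simp: subspace_def linear_0 linear_add linear_scale)
  have "DIM(('a \<times> real) \<times> real) \<le> Suc (dim ?V)"
    unfolding V using dim_le_Suc_dim_kernel[OF subspace_UNIV \<phi>] by simp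
  then show "2 * n + 1 \<le> dim ?V" using assms(1) by simp
  fix W assume W: "W \<in> ?V" "bm_eval (u_fun, beta) p W = 0"
    and ker: "\<And>X. X \<in> ?V \<Longrightarrow> bm_d_eval (u_fun, beta) p W X = 0"
  obtain v s h where W_eq: "W = ((v, s), h)" by (cases W) auto
  have "v = 0 \<and> s = 0 \<and> h = 0"
    using d_form_nondegenerate[of v "z_fun p ^ m" h "grad_u p" "grad_a p" "u_t p" "a_t p" s
        "u_fun p" "a_fun p" "fst p"] W ker assms(2)
    unfolding W_eq bm_fibre_iff bm_eval_eq bm_d_eval_eq
    by (simp add: density_reeb_x[of p m] reeb_x_def u_y_def a_y_def bm_fibre_iff)
  then show "W = 0" by (simp add: W_eq zero_prod_def)
qed (use reeb_properties[OF assms(2)] in auto)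

section \<open>Positivity\<close>

lemma bump_bounds: "0 \<le> bump x" "bump x \<le> 1"
  using flat_exp_nonneg flat_exp_0_le[of "1 - 2 * (x \<bullet> x)"] by (auto simp: bump_def)

lemma bump_eq_1D: "bump x = 1 \<Longrightarrow> x = 0"
  using flat_exp_0_eq[of "1 - 2 * (x \<bullet> x)"] by (simp add: bump_def)

lemma dbump_nonneg: "0 \<le> dbump x"
  using flat_exp_nonneg by (simp add: dbump_def)

lemma bump_0 [simp]: "bump 0 = 1"
  by (simp add: bump_def flat_exp_def flip: exp_add)

text \<open>
  The \<open>y\<close>-derivative of \<open>y\<close> times the bump function.
\<close>

definition bump_y :: "'a \<Rightarrow> real" where
  "bump_y x = bump x - 2 * (x \<bullet> e2)\<^sup>2 * dbump x"

lemma bump_y_le: "bump_y x \<le> bump x"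
  using dbump_nonneg by (simp add: bump_y_def)

lemma u_y_eq: "u_y p = 1 - kappa (snd p) * bump_y (fst p)"
  by (simp add: u_y_def grad_u_def bump_y_def inner_simps power2_eq_square algebra_simps)

lemma a_y_eq: "a_y p = - (epsilon (snd p) * bump_y (fst p))"
  by (simp add: a_y_def grad_a_def bump_y_def inner_simps power2_eq_square algebra_simps)

text \<open>
  Up to sign and a factor \<open>2\<close>, the derivative of the bump function along the radial field of the
  symplectic coordinates. It enters because \<open>\<lambda>\<close> pairs with a Hamiltonian vector field to half the radial
  derivative of the Hamiltonian.
\<close>

definition radial :: "'a \<Rightarrow> real" where
  "radial x = dbump x * (S x \<bullet> S x)"

lemma density_eq:
  "density p = epsilon (snd p) * bump_y (fst p) *
      (8 + (fst p \<bullet> e2) * (1 - kappa (snd p) * (bump (fst p) + radial (fst p)))) +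
    u_y p * (1 - epsilon (snd p) * (fst p \<bullet> e2) * (bump (fst p) + radial (fst p)))"
proof -
  have "S (grad_u p) = (2 * kappa (snd p) * (fst p \<bullet> e2) * dbump (fst p)) *\<^sub>R S (fst p)"
    "S (grad_a p) = (2 * epsilon (snd p) * (fst p \<bullet> e2) * dbump (fst p)) *\<^sub>R S (fst p)"
    by (simp_all add: grad_u_def grad_a_def)
  then have "S (fst p) \<bullet> S (u_y p *\<^sub>R grad_a p - a_y p *\<^sub>R grad_u p) / 2 =
      (fst p \<bullet> e2) * radial (fst p) * (u_y p * epsilon (snd p) - a_y p * kappa (snd p))"
    by (simp add: inner_simps radial_def field_simps)
  then show ?thesis
    unfolding density_def by (simp add: a_y_eq u_fun_def a_fun_def algebra_simps)
qed

lemma radial_bounds: "0 \<le> radial x" "radial x \<le> 6"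
proof -
  show "0 \<le> radial x" using dbump_nonneg by (simp add: radial_def)
  show "radial x \<le> 6"
  proof (cases "1 - 2 * (x \<bullet> x) > 0")
    case True
    have "S x \<bullet> S x = - (x \<bullet> S (S x))" by (rule S_skew)
    also have "\<dots> = x \<bullet> x - (x \<bullet> e1)\<^sup>2 - (x \<bullet> e2)\<^sup>2"
      by (simp add: S_S inner_simps power2_eq_square)
    finally have "S x \<bullet> S x \<le> x \<bullet> x" by simp
    then have 1: "S x \<bullet> S x \<le> 1 / 2" using True by linarith
    \<comment> \<open>\<open>exp 1 \<le> 3\<close> and \<open>flat_exp 2 \<le> 2\<close>\<close>
    have 2: "dbump x \<le> 2 * 3 * 2"
      unfolding dbump_def using exp_le flat_exp_2_le flat_exp_nonneg by (intro mult_mono) auto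
    have "dbump x * (S x \<bullet> S x) \<le> (2 * 3 * 2) * (1 / 2)"
      by (rule mult_mono[OF 2 1]) auto
    then show ?thesis by (simp add: radial_def)
  qed (simp add: radial_def dbump_def flat_exp_def)
qed

text \<open>
  By the choice of the bump function, \<open>bump_y \<le> bump \<le> 1\<close> with equality only at \<open>x = 0\<close>.
\<close>

lemma u_y_nonneg:
  assumes "snd p \<le> 1" "0 \<le> snd p"
  shows "0 \<le> u_y p" and "u_y p = 0 \<Longrightarrow> p = (0, 1)"
proof -
  have k: "0 \<le> kappa (snd p)" "kappa (snd p) \<le> 1" "15/16 \<le> kappa (snd p)" using assms by (auto simp: kappa_def)
  have b: "bump_y (fst p) \<le> bump (fst p)" by (rule bump_y_le)
  have le: "kappa (snd p) * bump_y (fst p) \<le> kappa (snd p) * bump (fst p)"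
    using k b by (intro mult_left_mono) auto
  have le2: "kappa (snd p) * bump (fst p) \<le> kappa (snd p)" "kappa (snd p) * bump (fst p) \<le> bump (fst p)"
    using k bump_bounds[of "fst p"] by (auto simp: mult_left_le mult_left_le_one_le)
  show "0 \<le> u_y p" using le le2 k unfolding u_y_eq by linarith
  assume "u_y p = 0"
  then have "1 \<le> kappa (snd p)" "1 \<le> bump (fst p)" using le le2 unfolding u_y_eq by linarith+
  then have "snd p = 1" "fst p = 0"
    using k bump_bounds(2)[of "fst p"] bump_eq_1D[of "fst p"] by (auto simp: kappa_def)
  then show "p = (0, 1)" by (simp add: prod_eq_iff)
qed

text \<open>
  Write the density as \<open>\<epsilon> \<theta> f + (1 - \<kappa> \<theta>) a\<close> with \<open>\<theta> = bump_y\<close> and positive \<open>f\<close>, \<open>a\<close>. For \<open>\<theta> > 0\<close> the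
  first term is positive and the second nonnegative, even where \<open>u\<^sub>y = 1 - \<kappa> \<theta>\<close> vanishes. For \<open>\<theta> \<le> 0\<close>
  it equals \<open>a + |\<theta>| (\<kappa> a - \<epsilon> f)\<close>, and \<open>\<epsilon>\<close> is small enough for the bracket to be positive.
\<close>

lemma density_pos:
  assumes "p \<in> trap_domain"
  shows "0 < density p"
proof -
  have t: "0 \<le> snd p" "snd p \<le> 1" and x: "norm (fst p) \<le> 1"
    using assms by (auto simp: trap_domain_def)
  define y where "y = fst p \<bullet> e2"
  define b where "b = bump (fst p)"
  define r where "r = radial (fst p)"
  define th where "th = bump_y (fst p)"
  define k where "k = kappa (snd p)"
  define ep where "ep = epsilon (snd p)"
  have k: "15 / 16 \<le> k" "k \<le> 1" and ep: "1 / 128 \<le> ep" "ep \<le> 1 / 64"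
    using t by (auto simp: k_def kappa_def ep_def epsilon_def)
  have br: "0 \<le> b + r" "b + r \<le> 7"
    using bump_bounds[of "fst p"] radial_bounds[of "fst p"] by (auto simp: b_def r_def)
  have "\<bar>y\<bar> \<le> norm (fst p) * norm e2" unfolding y_def by (rule Cauchy_Schwarz_ineq2)
  moreover have "norm e2 = 1" by (simp add: norm_eq_sqrt_inner)
  ultimately have y: "\<bar>y\<bar> \<le> 1" using x by simp
  \<comment> \<open>\<open>u\<close> and \<open>a\<close> corrected by the contribution of \<open>\<lambda>\<close>, as they occur in \<open>density_eq\<close>\<close>
  define f where "f = 8 + y * (1 - k * (b + r))"
  define a where "a = 1 - ep * y * (b + r)"
  have "k * (b + r) \<le> 1 * 7"
    by (rule mult_mono) (use k br in auto)
  moreover have "0 \<le> k * (b + r)"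
    using k br by simp
  ultimately have kb: "\<bar>1 - k * (b + r)\<bar> \<le> 6" by linarith
  have "\<bar>y * (1 - k * (b + r))\<bar> \<le> 1 * 6"
    unfolding abs_mult using y kb by (intro mult_mono) auto
  then have f: "2 \<le> f" "f \<le> 14" unfolding f_def by linarith+
  have "\<bar>ep * y * (b + r)\<bar> \<le> (1 / 64) * 1 * 7"
    unfolding abs_mult using y ep br by (intro mult_mono) auto
  then have a: "1 / 2 \<le> a" unfolding a_def by linarith
  have D: "density p = ep * th * f + (1 - k * th) * a"
    unfolding density_eq u_y_eq f_def a_def ep_def th_def k_def b_def r_def y_def by simp
  have uy: "0 \<le> 1 - k * th" using u_y_nonneg(1)[OF t(2,1)] by (simp add: u_y_eq k_def th_def)
  show ?thesis
  proof (cases "th > 0")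
    case True
    then have "0 < ep * th * f" using ep f by simp
    moreover have "0 \<le> (1 - k * th) * a" using uy a by simp
    ultimately show ?thesis unfolding D by linarith
  next
    case False
    \<comment> \<open>\<open>15 / 32\<close> exceeds \<open>14 / 64\<close>\<close>
    have "(15 / 16) * (1 / 2) \<le> k * a" using k a by (intro mult_mono) auto
    moreover have "ep * f \<le> (1 / 64) * 14" using ep f by (intro mult_mono) auto
    ultimately have "0 \<le> - th * (k * a - ep * f)" using False by (intro mult_nonneg_nonneg) auto
    moreover have "density p = a + - th * (k * a - ep * f)" unfolding D by (simp add: algebra_simps)
    ultimately show ?thesis using a by linarith
  qed
qed

section \<open>Smoothness\<close>

lemmas Ck_on_rules = Ck_on_add Ck_on_diff Ck_on_minus Ck_on_mult Ck_on_power Ck_on_divide_const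
  Ck_on_bilinear[OF _ bounded_bilinear_inner] Ck_on_bilinear[OF _ bounded_bilinear_scaleR]
  Ck_on_fst Ck_on_snd Ck_on_const Ck_on_flat_exp
  Ck_on_bounded_linear[OF _ linear_S[unfolded linear_conv_bounded_linear]]
  Ck_on_bounded_linear[OF _ bounded_linear_primitive]

lemma Ck_on_pieces:
  assumes "open U"
  shows "Ck_on k U u_fun" "Ck_on k U a_fun" "Ck_on k U beta" "Ck_on k U z_fun" "Ck_on k U grad_u" "Ck_on k U grad_a"
    "Ck_on k U u_t" "Ck_on k U u_y" "Ck_on k U a_y" "Ck_on k U density" "Ck_on k U (reeb_x m)"
  unfolding u_fun_def[abs_def] a_fun_def[abs_def] beta_def[abs_def] z_fun_def[abs_def]
    grad_u_def[abs_def] grad_a_def[abs_def] u_t_def[abs_def] u_y_def[abs_def] a_y_def[abs_def]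
    density_def[abs_def] reeb_x_def[abs_def] reeb_direction_def bump_def dbump_def kappa_def epsilon_def
  by (intro Ck_on_rules assms)+

section \<open>The trap\<close>

lemma smooth_near_reeb:
  "smooth_near trap_domain (reeb m)" "smooth_near trap_domain reeb_h"
proof -
  let ?U = "{p. density p \<noteq> 0}"
  have "continuous_on UNIV density" using Ck_on_pieces(10)[of UNIV 0] by simp
  then have U: "open ?U" by (intro open_Collect_neq) (auto intro: continuous_intros)
  have sub: "trap_domain \<subseteq> ?U" using density_pos by force
  have inv: "Ck_on k ?U (\<lambda>p. inverse (density p))" for k
    by (rule Ck_on_inverse[OF U _ Ck_on_pieces(10)[OF U]]) simp
  have "Ck_on k ?U (reeb m)" for k
    unfolding reeb_def[abs_def]
    by (intro Ck_on_bilinear[OF U bounded_bilinear_scaleR] inv Ck_on_Pair Ck_on_pieces U)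
  then show "smooth_near trap_domain (reeb m)"
    unfolding smooth_near_def using U sub by blast
  have "Ck_on k ?U reeb_h" for k
    unfolding reeb_h_def[abs_def]
    by (intro Ck_on_minus Ck_on_mult inv Ck_on_pieces U)
  then show "smooth_near trap_domain reeb_h"
    unfolding smooth_near_def using U sub by blast
qed

lemma reeb_outside_bump:
  assumes "1 / 2 < fst p \<bullet> fst p"
  shows "reeb m p = (0, 1)"
proof -
  have "bump (fst p) = 0" "dbump (fst p) = 0"
    using assms by (simp_all add: bump_def dbump_def flat_exp_def)
  then have "grad_u p = e2" "grad_a p = 0" "u_t p = 0" "a_fun p = 1"
    by (simp_all add: grad_u_def grad_a_def u_t_def a_fun_def)
  then show ?thesis
    by (simp add: reeb_def reeb_x_def reeb_direction_def density_def u_y_def a_y_def)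
qed

text \<open>
  On the axis all components transverse to it vanish: the one along \<open>z\<^sup>m \<partial>\<^sub>z\<close> because the axis lies in the
  critical hypersurface and \<open>m \<ge> 1\<close>, the others because the perturbation is divisible by \<open>y\<close>.
\<close>

lemma reeb_axis:
  assumes "m \<ge> 1"
  shows "reeb m (0, t) = (0, (1 - t) / 2)"
proof -
  have "grad_u (0, t) = (1 - kappa t) *\<^sub>R e2" "grad_a (0, t) = - (epsilon t *\<^sub>R e2)" "u_t (0, t) = 0"
    "z_fun (0, t) = 0"
    by (simp_all add: grad_u_def grad_a_def u_t_def z_fun_def)
  then have "reeb_x m (0, t) = 0"
    using assms by (simp add: reeb_x_def reeb_direction_def)
  moreover have "u_y (0, t) = (1 - t) / 16"
    by (simp add: u_y_eq bump_y_def kappa_def field_simps)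
  moreover have "density (0, t) = 1 / 8"
    by (simp add: density_eq u_y_eq bump_y_def radial_def kappa_def epsilon_def field_simps)
  ultimately show ?thesis unfolding reeb_def by (simp only:) simp
qed

text \<open>
  Since \<open>u\<^sub>y \<ge> 0\<close>, the function \<open>t\<close> is nondecreasing along orbits. On a periodic orbit it is constant, so
  \<open>u\<^sub>y\<close> vanishes along the orbit, which happens at the single point \<open>(0, 1)\<close> only. The orbit from the
  origin solves \<open>t' = (1 - t) / 2\<close> and needs infinite time to reach that point.
\<close>

lemma trap_reeb:
  assumes "m \<ge> 1"
  shows "trap (reeb m)"
  unfolding trap_def
proof (intro conjI allI impI)
  show "smooth_near trap_domain (reeb m)" by (rule smooth_near_reeb)
  show "\<exists>U. open U \<and> sphere 0 1 \<times> {0..1} \<subseteq> U \<and> (\<forall>p\<in>U \<inter> trap_domain. reeb m p = (0, 1))"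
  proof (intro exI[of _ "{p. 1 / 2 < fst p \<bullet> fst p}"] conjI)
    show "open {p :: 'a \<times> real. 1 / 2 < fst p \<bullet> fst p}"
      by (intro open_Collect_less continuous_intros)
  qed (auto simp: reeb_outside_bump dot_square_norm)
  show "0 < snd (reeb m (0, 0))" using reeb_axis[OF assms, of 0] by simp
next
  fix \<gamma> :: "real \<Rightarrow> 'a \<times> real" and T s
  assume A: "T > 0 \<and> (\<forall>s. \<gamma> s \<in> trap_domain \<and> (\<gamma> has_vector_derivative reeb m (\<gamma> s)) (at s) \<and>
    \<gamma> (s + T) = \<gamma> s)"
  have d: "((\<lambda>s. snd (\<gamma> s)) has_real_derivative snd (reeb m (\<gamma> s))) (at s)" for s
    using A bounded_linear.has_vector_derivative[OF bounded_linear_snd, of \<gamma> "reeb m (\<gamma> s)" "at s"]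
    by (simp add: has_real_derivative_iff_has_vector_derivative)
  have uy: "0 \<le> u_y (\<gamma> s)" "0 < density (\<gamma> s)" for s
    using A u_y_nonneg(1)[of "\<gamma> s"] density_pos[of "\<gamma> s"] by (auto simp: trap_domain_def mem_Times_iff)
  then have nonneg: "0 \<le> snd (reeb m (\<gamma> s))" for s
    by (simp add: reeb_def less_imp_le)
  have mono: "snd (\<gamma> a) \<le> snd (\<gamma> b)" if "a \<le> b" for a b
    by (rule DERIV_nonneg_imp_nondecreasing[OF that]) (use d nonneg in blast)
  have "\<gamma> s = (0, 1)" for s
  proof -
    have per: "snd (\<gamma> (s - T)) = snd (\<gamma> s)" "snd (\<gamma> (s + T)) = snd (\<gamma> s)"
      using A[THEN conjunct2, rule_format, of "s - T"] A[THEN conjunct2, rule_format, of s] by auto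
    \<comment> \<open>a monotone periodic function is constant over the periods on both sides of \<open>s\<close>\<close>
    have "snd (\<gamma> s) = snd (\<gamma> r)" if "\<bar>s - r\<bar> < T" for r
      using mono[of "s - T" r] mono[of r "s + T"] mono[of s r] mono[of r s] per that by linarith
    then have "snd (reeb m (\<gamma> s)) = 0"
      using DERIV_local_const[OF d, of T s] A by blast
    then have "u_y (\<gamma> s) = 0" using uy(2)[of s] by (simp add: reeb_def)
    then show ?thesis
      using A u_y_nonneg(2)[of "\<gamma> s"] by (auto simp: trap_domain_def mem_Times_iff)
  qed
  then show "\<gamma> s = \<gamma> 0" by metis
next
  let ?\<gamma> = "\<lambda>s. (0 :: 'a, 1 - exp (- s / 2)) :: 'a \<times> real"
  have "(?\<gamma> has_vector_derivative reeb m (?\<gamma> s)) (at s within {0..})" for s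
    unfolding reeb_axis[OF assms]
    by (intro has_vector_derivative_Pair has_vector_derivative_const)
      (auto intro!: derivative_eq_intros simp flip: has_real_derivative_iff_has_vector_derivative)
  then show "\<exists>\<gamma>. \<gamma> 0 = (0, 0) \<and> (\<forall>s\<ge>0. \<gamma> s \<in> trap_domain \<and>
      (\<gamma> has_vector_derivative reeb m (\<gamma> s)) (at s within {0..}))"
    by (intro exI[of _ ?\<gamma>]) (simp add: trap_domain_def)
qed

lemma bm_contact_trap_reeb:
  assumes "m \<ge> 1" "DIM('a) = 2 * n"
  shows "bm_contact_trap m (reeb m)"
  unfolding bm_contact_trap_def
proof (intro conjI exI)
  show "trap (reeb m)" by (rule trap_reeb[OF assms(1)])
  have "(\<lambda>w :: 'a \<times> real. fst w \<bullet> e1) \<noteq> (\<lambda>w. 0)"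
    by (auto simp: fun_eq_iff intro!: exI[of _ e1])
  moreover have "(0, 1 / 2) \<in> interior (trap_domain :: ('a \<times> real) set)"
    by (simp add: trap_domain_def interior_Times)
  ultimately have "defining_function trap_domain z_fun"
    unfolding defining_function_def frechet_z_fun
    by (auto simp: z_fun_def intro!: smooth_near_UNIV Ck_on_pieces bexI[of _ "(0, 1 / 2)"])
  moreover have "bm_smooth_form trap_domain (u_fun, beta)"
    unfolding bm_smooth_form_def by (auto intro!: smooth_near_UNIV Ck_on_pieces)
  moreover have "\<exists>v. (\<forall>i. v i \<in> bm_fibre m z_fun p) \<and> bm_volume n (u_fun, beta) p v \<noteq> 0"
    if "p \<in> trap_domain" for p
    by (rule bm_volume_nonzero[OF assms(2)]) (use density_pos[OF that] in simp)
  ultimately show "bm_contact_form m n trap_domain z_fun (u_fun, beta)"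
    unfolding bm_contact_form_def using assms(2) by simp
  have "density p \<noteq> 0" if "p \<in> trap_domain" for p using density_pos[OF that] by simp
  then show "bm_reeb_field m trap_domain z_fun (u_fun, beta) (reeb m)"
    unfolding bm_reeb_field_def
    by (intro conjI smooth_near_reeb exI[of _ reeb_h] ballI reeb_properties)
qed

end

theorem theorem7p1:
  fixes m n :: nat
  assumes "m \<ge> 1" and "n \<ge> 1" and "DIM('a::euclidean_space) = 2 * n"
  shows "\<exists>X :: 'a \<times> real \<Rightarrow> 'a \<times> real. bm_contact_trap m X"
proof -
  obtain e1 e2 :: 'a and S where "partial_complex e1 e2 S"
    using ex_partial_complex_structure[OF assms(3,2)] unfolding partial_complex_def by blast
  then show ?thesis
    using partial_complex.bm_contact_trap_reeb[OF _ assms(1,3)] by blast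
qed

end
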